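(* Let $G=(U,E)$ be a connected simple graph and $k<|E|$ a positive integer. If $k\ge2$ and $\mathcal F_{e,*}(G,k)$ (for $*\in\{c,t\}$) is minimal transversal-free, then it is JM (as a hypergraph on ground set $E$). Similarly, if $k\ge1$ and $\mathcal F_{v,*}(G,k)$ (for $*\in\{c,t\}$) is minimal transversal-free, then it is JM (as a hypergraph on ground set $U$).
   Context: For $F\subseteq E$, $U(F)$ denotes the set of vertices incident to at least one edge of $F$. Define $\mathcal F_{e,c}(G,k)=\{F\subseteq E: |F|=k,\ (U(F),F)\text{ connected}\}$; $\mathcal F_{v,c}(G,k)=\{U(F): F\subseteq E,\ |F|=k,\ (U(F),F)\text{ connected}\}$; $\mathcal F_{e,t}(G,k)=\{F\subseteq E: |F|=k,\ (U(F),F)\text{ a tree}\}$; $\mathcal F_{v,t}(G,k)=\{U(F): F\subseteq E,\ |F|=k,\ (U(F),F)\text{ a tree}\}$. For a hypergraph $\mathcal H$ on a finite ground set $V$ (nonempty, no empty hyperedge): the game $NIM_{\mathcal H}$ is played on positions $x\in\mathbb{Z}_{\ge 0}^V$; a move $x\to x'$ chooses $H\in\mathcal H$ and goes to any $x'\in\mathbb Z_{\ge0}^V$ with $x'_i<x_i$ for $i\in H$ and $x'_i=x_i$ for $i\notin H$; players alternate and the player who cannot move loses. The Sprague–Grundy function is $\mathcal G_{\mathcal H}(x)=\mathrm{mex}\{\mathcal G_{\mathcal H}(x') : x\to x' \text{ a move}\}$. The height $h_{\mathcal H}(x)$ is the maximum number of consecutive moves possible from $x$. With $e$ the all-ones vector,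 $m(x)=\min_{i}x_i$, $y_{\mathcal H}(x)=h_{\mathcal H}(x-m(x)e)+1$, $v_{\mathcal H}(x)=\binom{y_{\mathcal H}(x)}{2}+\big((m(x)-\binom{y_{\mathcal H}(x)}{2}-1)\bmod y_{\mathcal H}(x)\big)$ (residue in $\{0,\dots,y_{\mathcal H}(x)-1\}$), $f_{\mathcal H}(x)=h_{\mathcal H}(x)$ if $m(x)\le\binom{y_{\mathcal H}(x)}{2}$, else $v_{\mathcal H}(x)$. $\mathcal H$ is JM if $\mathcal G_{\mathcal H}=f_{\mathcal H}$. $\mathcal H$ is transversal-free if for each $H\in\mathcal H$ there is a hyperedge disjoint from it; with $\mathcal H_S=\{H\in\mathcal H:H\subseteq S\}$, $\mathcal H$ is minimal transversal-free if it is transversal-free and for every $S\subsetneq V$ with $\mathcal H_S\neq\emptyset$ some hyperedge of $\mathcal H_S$ meets all hyperedges of $\mathcal H_S$. *)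

theory Defs
  imports Complex_Main
begin

section \<open>Finite simple graphs\<close>

text \<open>A graph is given by its vertex set and its edge set; an edge is an unordered pair of
  distinct vertices.\<close>

definition simple_graph :: "'a set \<Rightarrow> 'a set set \<Rightarrow> bool" where
  "simple_graph U E \<longleftrightarrow> finite U \<and> (\<forall>e\<in>E. e \<subseteq> U \<and> card e = 2)"

definition adjacency :: "'a set set \<Rightarrow> ('a \<times> 'a) set" where
  "adjacency E = {(u, v). {u, v} \<in> E}"

definition connected_graph :: "'a set \<Rightarrow> 'a set set \<Rightarrow> bool" where
  "connected_graph U E \<longleftrightarrow> U \<noteq> {} \<and> (\<forall>u\<in>U. \<forall>v\<in>U. (u, v) \<in> (adjacency E)\<^sup>*)"

definition graph_cycle :: "'a set set \<Rightarrow> 'a list \<Rightarrow> bool" where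
  "graph_cycle E vs \<longleftrightarrow> 3 \<le> length vs \<and> distinct vs \<and>
     (\<forall>i<length vs. {vs ! i, vs ! (Suc i mod length vs)} \<in> E)"

definition tree_graph :: "'a set \<Rightarrow> 'a set set \<Rightarrow> bool" where
  "tree_graph U E \<longleftrightarrow> connected_graph U E \<and> (\<nexists>vs. graph_cycle E vs)"

definition incident_vertices :: "'a set set \<Rightarrow> 'a set" where
  "incident_vertices F = {u. \<exists>e\<in>F. u \<in> e}"

text \<open>The families depend on the graph only through its edge set.\<close>

definition F_ec :: "'a set set \<Rightarrow> nat \<Rightarrow> 'a set set set" where
  "F_ec E k = {F. F \<subseteq> E \<and> card F = k \<and> connected_graph (incident_vertices F) F}"

definition F_vc :: "'a set set \<Rightarrow> nat \<Rightarrow> 'a set set" where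
  "F_vc E k = {incident_vertices F | F.
     F \<subseteq> E \<and> card F = k \<and> connected_graph (incident_vertices F) F}"

definition F_et :: "'a set set \<Rightarrow> nat \<Rightarrow> 'a set set set" where
  "F_et E k = {F. F \<subseteq> E \<and> card F = k \<and> tree_graph (incident_vertices F) F}"

definition F_vt :: "'a set set \<Rightarrow> nat \<Rightarrow> 'a set set" where
  "F_vt E k = {incident_vertices F | F.
     F \<subseteq> E \<and> card F = k \<and> tree_graph (incident_vertices F) F}"


section \<open>The game NIM on a hypergraph\<close>

text \<open>A hypergraph on a finite ground set \<open>V\<close> is a set \<open>\<H>\<close> of nonempty subsets of \<open>V\<close>. Positions
  are total functions \<open>'v \<Rightarrow> nat\<close>; hyperedges lie inside \<open>V\<close>, so a move never changes the values
  outside \<open>V\<close>, and these values are irrelevant to every notion below.\<close>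

definition nim_move :: "'v set set \<Rightarrow> ('v \<Rightarrow> nat) \<Rightarrow> ('v \<Rightarrow> nat) \<Rightarrow> bool" where
  "nim_move \<H> x x' \<longleftrightarrow> (\<exists>A\<in>\<H>. (\<forall>i\<in>A. x' i < x i) \<and> (\<forall>i. i \<notin> A \<longrightarrow> x' i = x i))"

definition mex :: "nat set \<Rightarrow> nat" where
  "mex S = (LEAST n. n \<notin> S)"

text \<open>Well-founded recursion along moves; lemma \<open>sprague_grundy_rec\<close> below gives the recursion
  equation, which is where the hypergraph conditions are needed.\<close>

definition sprague_grundy :: "'v set set \<Rightarrow> ('v \<Rightarrow> nat) \<Rightarrow> nat" where
  "sprague_grundy \<H> =
     wfrec {(x', x). nim_move \<H> x x'} (\<lambda>g x. mex {g x' | x'. nim_move \<H> x x'})"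

text \<open>Lemma \<open>finite_play_lengths\<close> below ensures that the maximum exists.\<close>

definition height :: "'v set set \<Rightarrow> ('v \<Rightarrow> nat) \<Rightarrow> nat" where
  "height \<H> x = Max {n. \<exists>x'. (nim_move \<H> ^^ n) x x'}"

definition min_pile :: "'v set \<Rightarrow> ('v \<Rightarrow> nat) \<Rightarrow> nat" where
  "min_pile V x = Min (x ` V)"

definition y_val :: "'v set \<Rightarrow> 'v set set \<Rightarrow> ('v \<Rightarrow> nat) \<Rightarrow> nat" where
  "y_val V \<H> x = height \<H> (\<lambda>i. x i - min_pile V x) + 1"

text \<open>The residue is taken over the integers, since the argument of \<open>mod\<close> may be negative.\<close>

definition v_val :: "'v set \<Rightarrow> 'v set set \<Rightarrow> ('v \<Rightarrow> nat) \<Rightarrow> nat" where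
  "v_val V \<H> x = (y_val V \<H> x choose 2) +
     nat ((int (min_pile V x) - int (y_val V \<H> x choose 2) - 1) mod int (y_val V \<H> x))"

definition f_val :: "'v set \<Rightarrow> 'v set set \<Rightarrow> ('v \<Rightarrow> nat) \<Rightarrow> nat" where
  "f_val V \<H> x =
     (if min_pile V x \<le> (y_val V \<H> x choose 2) then height \<H> x else v_val V \<H> x)"

definition JM :: "'v set \<Rightarrow> 'v set set \<Rightarrow> bool" where
  "JM V \<H> \<longleftrightarrow> (\<forall>x. sprague_grundy \<H> x = f_val V \<H> x)"

definition transversal_free :: "'v set set \<Rightarrow> bool" where
  "transversal_free \<H> \<longleftrightarrow> (\<forall>A\<in>\<H>. \<exists>B\<in>\<H>. A \<inter> B = {})"

definition induced :: "'v set set \<Rightarrow> 'v set \<Rightarrow> 'v set set" where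
  "induced \<H> S = {A\<in>\<H>. A \<subseteq> S}"

definition minimal_transversal_free :: "'v set \<Rightarrow> 'v set set \<Rightarrow> bool" where
  "minimal_transversal_free V \<H> \<longleftrightarrow> transversal_free \<H> \<and>
     (\<forall>S. S \<subset> V \<and> induced \<H> S \<noteq> {} \<longrightarrow>
        (\<exists>A\<in>induced \<H> S. \<forall>B\<in>induced \<H> S. A \<inter> B \<noteq> {}))"


section \<open>Well-definedness\<close>

lemma nim_move_sum_less:
  assumes "finite V" "\<H> \<subseteq> Pow V - {{}}" "nim_move \<H> x x'"
  shows "sum x' V < sum x V"
proof -
  obtain A where A: "A \<in> \<H>" "\<forall>i\<in>A. x' i < x i" "\<forall>i. i \<notin> A \<longrightarrow> x' i = x i"
    using assms(3) unfolding nim_move_def by blast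
  then obtain a where "a \<in> A" "a \<in> V" using assms(2) by blast
  moreover have "x' i \<le> x i" for i using A by (cases "i \<in> A") (auto intro: less_imp_le)
  ultimately show ?thesis using A(2) assms(1) by (intro sum_strict_mono_ex1) auto
qed

lemma wf_nim_move:
  assumes "finite V" "\<H> \<subseteq> Pow V - {{}}"
  shows "wf {(x', x). nim_move \<H> x x'}"
  by (rule wf_subset[OF wf_measure[of "\<lambda>x. sum x V"]])
    (auto dest: nim_move_sum_less[OF assms])

lemma sprague_grundy_rec:
  assumes "finite V" "\<H> \<subseteq> Pow V - {{}}"
  shows "sprague_grundy \<H> x = mex {sprague_grundy \<H> x' | x'. nim_move \<H> x x'}"
proof -
  let ?R = "{(x', x). nim_move \<H> x x'}"
  have eq: "{cut (sprague_grundy \<H>) ?R x x' | x'. nim_move \<H> x x'} =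
      {sprague_grundy \<H> x' | x'. nim_move \<H> x x'}"
    by (rule Collect_cong) (auto simp: cut_def)
  have "sprague_grundy \<H> x = mex {cut (sprague_grundy \<H>) ?R x x' | x'. nim_move \<H> x x'}"
    using wfrec[OF wf_nim_move[OF assms], of "\<lambda>g x. mex {g x' | x'. nim_move \<H> x x'}" x]
    unfolding sprague_grundy_def by simp
  then show ?thesis using eq by simp
qed

lemma play_length_le:
  assumes "finite V" "\<H> \<subseteq> Pow V - {{}}"
  shows "(nim_move \<H> ^^ n) x x' \<Longrightarrow> n + sum x' V \<le> sum x V"
proof (induction n arbitrary: x')
  case (Suc n)
  then obtain z where "(nim_move \<H> ^^ n) x z" "nim_move \<H> z x'" by auto
  with Suc.IH[of z] nim_move_sum_less[OF assms, of z x'] show ?case by simp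
qed simp

lemma finite_play_lengths:
  assumes "finite V" "\<H> \<subseteq> Pow V - {{}}"
  shows "finite {n. \<exists>x'. (nim_move \<H> ^^ n) x x'}"
  by (rule finite_subset[of _ "{..sum x V}"]) (auto dest: play_length_le[OF assms])

lemma families_are_hypergraphs:
  assumes "simple_graph U E" "1 \<le> k"
  shows "finite E" "finite U"
    and "F_ec E k \<subseteq> Pow E - {{}}" "F_et E k \<subseteq> Pow E - {{}}"
    and "F_vc E k \<subseteq> Pow U - {{}}" "F_vt E k \<subseteq> Pow U - {{}}"
proof -
  show "finite U" using assms(1) by (simp add: simple_graph_def)
  then show "finite E"
    using assms(1) by (auto simp: simple_graph_def intro: finite_subset[of E "Pow U"])
  show "F_ec E k \<subseteq> Pow E - {{}}" "F_et E k \<subseteq> Pow E - {{}}"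
    using assms(2) by (auto simp: F_ec_def F_et_def)
  show "F_vc E k \<subseteq> Pow U - {{}}" "F_vt E k \<subseteq> Pow U - {{}}"
    using assms(1)
    by (auto 0 3 simp: F_vc_def F_vt_def tree_graph_def connected_graph_def
        simple_graph_def incident_vertices_def)
qed

end

theory Submission
  imports Defs
begin

text \<open>The height is the maximal size of a packing of hyperedges. That no move preserves \<open>f\<close> only needs
  that every hyperedge has a disjoint one. To reach every smaller value, use two properties of
  connected edge sets and trees with \<open>k\<close> edges, obtained by adding an edge and removing another one:
  any two of them are linked by such exchanges (inside their union, if they share a vertex), and the
  elements used by optimal packings spread along the graph. Let \<open>i\<close> be a smallest pile and \<open>T\<close> a
  hyperedge meeting all hyperedges that avoid \<open>i\<close>; emptying \<open>T\<close> leaves height at most \<open>x i\<close>. Start with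
  a hyperedge through \<open>i\<close>, lower \<open>i\<close>, and then exchange towards \<open>T\<close>, keeping an empty pile (after
  subtracting the prescribed minimum): the height drops by at most one at a time, so all intermediate
  values occur. If the first hyperedge belongs to an optimal packing, this reaches every height from
  \<open>m(x)\<close> to \<open>h(x) - 1\<close>, and when \<open>m(x) \<le> (y(x) choose 2)\<close> all positions on the way satisfy
  that inequality as well. Values below \<open>m(x)\<close> are reached by prescribing both the minimum and \<open>y\<close>.\<close>

section \<open>Heights as packing numbers\<close>

text \<open>Packings are lists and not sets, because an optimal packing may have to repeat a
  hyperedge.\<close>

definition usage :: "'v set list \<Rightarrow> 'v \<Rightarrow> nat" where
  "usage As i = length (filter (\<lambda>A. i \<in> A) As)"

lemma usage_Nil [simp]: "usage [] i = 0"
  and usage_Cons [simp]: "usage (A # As) i = of_bool (i \<in> A) + usage As i"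
  and usage_append [simp]: "usage (As @ Bs) i = usage As i + usage Bs i"
  and usage_replicate [simp]: "usage (replicate n A) i = (if i \<in> A then n else 0)"
  by (simp_all add: usage_def)

lemma usage_take_le: "usage (take n As) i \<le> usage As i"
  by (metis append_take_drop_id le_add1 usage_append)

lemma usage_remove1: "A \<in> set As \<Longrightarrow> usage As i = of_bool (i \<in> A) + usage (remove1 A As) i"
  by (induction As) auto

lemma usage_eq_0_iff: "usage As i = 0 \<longleftrightarrow> (\<forall>A\<in>set As. i \<notin> A)"
  by (induction As) auto

lemma usage_eq_length: "(\<And>A. A \<in> set As \<Longrightarrow> i \<in> A) \<Longrightarrow> usage As i = length As"
  by (induction As) auto

definition packs :: "'v set set \<Rightarrow> 'v set list \<Rightarrow> ('v \<Rightarrow> nat) \<Rightarrow> bool" where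
  "packs \<H> As x \<longleftrightarrow> set As \<subseteq> \<H> \<and> (\<forall>i. usage As i \<le> x i)"

text \<open>A move takes at least one token from each pile of its hyperedge. Keeping the final
  position \<open>x'\<close> in the bound carries the induction through.\<close>

lemma packs_of_play:
  "(nim_move \<H> ^^ n) x x' \<Longrightarrow>
    \<exists>As. length As = n \<and> set As \<subseteq> \<H> \<and> (\<forall>i. usage As i + x' i \<le> x i)"
proof (induction n arbitrary: x')
  case 0
  then show ?case by auto
next
  case (Suc n)
  then obtain z where z: "(nim_move \<H> ^^ n) x z" "nim_move \<H> z x'" by auto
  from Suc.IH[OF z(1)] obtain As where
    As: "length As = n" "set As \<subseteq> \<H>" "\<And>i. usage As i + z i \<le> x i" by blast
  from z(2) obtain A where A: "A \<in> \<H>" "\<And>i. i \<in> A \<Longrightarrow> x' i < z i" "\<And>i. i \<notin> A \<Longrightarrow> x' i = z i"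
    unfolding nim_move_def by blast
  have "usage (A # As) i + x' i \<le> x i" for i
    using A(2,3)[of i] As(3)[of i] by (cases "i \<in> A") auto
  then show ?case using As(1,2) A(1) by (intro exI[of _ "A # As"]) auto
qed

text \<open>Moves that take exactly one token per pile play the list from its last element to its
  first.\<close>

lemma play_of_packs:
  "packs \<H> As x \<Longrightarrow> (nim_move \<H> ^^ length As) x (\<lambda>i. x i - usage As i)"
proof (induction As)
  case (Cons A As)
  have le: "of_bool (i \<in> A) + usage As i \<le> x i" for i
    using Cons.prems by (simp add: packs_def)
  have "packs \<H> As x" using Cons.prems le by (auto simp: packs_def intro: add_leD2)
  moreover have "nim_move \<H> (\<lambda>i. x i - usage As i) (\<lambda>i. x i - usage (A # As) i)"
    unfolding nim_move_def
  proof (intro bexI[of _ A] conjI ballI allI impI)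
    fix i assume "i \<in> A"
    then show "x i - usage (A # As) i < x i - usage As i" using le[of i] by simp
  qed (use Cons.prems in \<open>auto simp: packs_def\<close>)
  ultimately show ?case using Cons.IH by (auto intro: relpow_Suc_I)
qed simp

locale hypergraph =
  fixes V :: "'v set" and \<H> :: "'v set set"
  assumes finite_V: "finite V" and edges: "\<H> \<subseteq> Pow V - {{}}"
begin

lemma edge_subset: "A \<in> \<H> \<Longrightarrow> A \<subseteq> V"
  using edges by auto

lemma edge_nonempty: "A \<in> \<H> \<Longrightarrow> A \<noteq> {}"
  using edges by auto

text \<open>Combines the two translations; a prefix of a packing is again a packing, so all lengths
  up to the maximum occur.\<close>

lemma le_height_iff: "n \<le> height \<H> x \<longleftrightarrow> (\<exists>As. length As = n \<and> packs \<H> As x)"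
proof
  let ?N = "{n. \<exists>x'. (nim_move \<H> ^^ n) x x'}"
  have fin: "finite ?N" by (rule finite_play_lengths[OF finite_V edges])
  { assume n: "n \<le> height \<H> x"
    have "0 \<in> ?N" by simp
    then have "height \<H> x \<in> ?N"
      unfolding height_def by (intro Max_in fin) blast
    then obtain x' where "(nim_move \<H> ^^ height \<H> x) x x'" by blast
    from packs_of_play[OF this] obtain As where
      As: "length As = height \<H> x" "set As \<subseteq> \<H>" "\<And>i. usage As i + x' i \<le> x i" by blast
    have "usage (take n As) i \<le> x i" for i
      using usage_take_le[of n As i] As(3)[of i] by simp
    moreover have "set (take n As) \<subseteq> \<H>" using As(2) by (meson order_trans set_take_subset)
    ultimately have "packs \<H> (take n As) x" by (simp add: packs_def)
    then show "\<exists>As. length As = n \<and> packs \<H> As x"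
      using As(1) n by (intro exI[of _ "take n As"]) simp }
  { assume "\<exists>As. length As = n \<and> packs \<H> As x"
    then have "n \<in> ?N" using play_of_packs by blast
    then show "n \<le> height \<H> x" unfolding height_def by (rule Max_ge[OF fin]) }
qed

lemma usage_outside: "set As \<subseteq> \<H> \<Longrightarrow> i \<notin> V \<Longrightarrow> usage As i = 0"
  using edge_subset by (auto simp: usage_eq_0_iff)

section \<open>Changes of the height under small changes of the position\<close>

lemma packs_mono: "packs \<H> As x \<Longrightarrow> (\<And>i. i \<in> V \<Longrightarrow> x i \<le> x' i) \<Longrightarrow> packs \<H> As x'"
  unfolding packs_def by (metis le_trans le0 usage_outside)

lemma height_mono: "(\<And>i. i \<in> V \<Longrightarrow> x i \<le> x' i) \<Longrightarrow> height \<H> x \<le> height \<H> x'"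
  using le_height_iff packs_mono by (metis order_refl)

lemma height_cong: "(\<And>i. i \<in> V \<Longrightarrow> x i = x' i) \<Longrightarrow> height \<H> x = height \<H> x'"
  by (intro antisym height_mono) auto

text \<open>At most one hyperedge through \<open>j\<close> has to be discarded from an optimal
  packing.\<close>

lemma height_decrement_le: "height \<H> x \<le> height \<H> (x(j := x j - 1)) + 1"
proof -
  obtain As where As: "length As = height \<H> x" "packs \<H> As x"
    using le_height_iff by blast
  let ?x = "x(j := x j - 1)"
  have "\<exists>Bs. height \<H> x \<le> length Bs + 1 \<and> packs \<H> Bs ?x"
  proof (cases "\<exists>A\<in>set As. j \<in> A")
    case True
    then obtain A where A: "A \<in> set As" "j \<in> A" by blast
    have "usage (remove1 A As) i \<le> ?x i" for i
    proof -
      have "usage As i \<le> x i" using As(2) by (simp add: packs_def)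
      then show ?thesis using usage_remove1[OF A(1), of i] A(2) by (cases "i = j") auto
    qed
    moreover have "set (remove1 A As) \<subseteq> \<H>"
      using As(2) unfolding packs_def by (meson order_trans set_remove1_subset)
    ultimately show ?thesis
      using As(1) A(1) by (intro exI[of _ "remove1 A As"]) (auto simp: packs_def length_remove1)
  next
    case False
    then have "usage As j = 0" by (simp add: usage_eq_0_iff)
    then have "packs \<H> As ?x" using As(2) by (auto simp: packs_def)
    then show ?thesis using As(1) by (intro exI[of _ As]) simp
  qed
  then obtain Bs where "height \<H> x \<le> length Bs + 1" "packs \<H> Bs ?x" by blast
  moreover from this(2) have "length Bs \<le> height \<H> ?x" using le_height_iff by blast
  ultimately show ?thesis by linarith
qed

lemma height_add: "height \<H> a + height \<H> b \<le> height \<H> (\<lambda>i. a i + b i)"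
proof -
  obtain As Bs where "length As = height \<H> a" "packs \<H> As a" "length Bs = height \<H> b" "packs \<H> Bs b"
    using le_height_iff by blast
  then show ?thesis unfolding le_height_iff
    by (intro exI[of _ "As @ Bs"]) (auto simp: packs_def add_mono)
qed

lemma height_ge_pile: "B \<in> \<H> \<Longrightarrow> (\<And>i. i \<in> B \<Longrightarrow> d \<le> x i) \<Longrightarrow> d \<le> height \<H> x"
  unfolding le_height_iff by (intro exI[of _ "replicate d B"]) (auto simp: packs_def)

lemma packs_positive: "packs \<H> As x \<Longrightarrow> A \<in> set As \<Longrightarrow> j \<in> A \<Longrightarrow> 0 < x j"
  unfolding packs_def by (metis gr0I le_zero_eq usage_eq_0_iff)

text \<open>Every member of a packing has only positive piles, hence contains \<open>i\<close>, so
  pile \<open>i\<close> pays for each of them.\<close>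

lemma height_le_pile:
  assumes "\<And>A. A \<in> \<H> \<Longrightarrow> (\<And>j. j \<in> A \<Longrightarrow> 0 < x j) \<Longrightarrow> i \<in> A"
  shows "height \<H> x \<le> x i"
proof -
  obtain As where As: "length As = height \<H> x" "packs \<H> As x"
    using le_height_iff by blast
  have "usage As i = length As"
    using assms As(2) packs_positive[OF As(2)]
    by (intro usage_eq_length) (auto simp: packs_def)
  then show ?thesis using As by (metis packs_def)
qed

lemma height_remove_packed:
  assumes "packs \<H> As x" "length As = height \<H> x" "A \<in> set As"
  shows "height \<H> x \<le> height \<H> (\<lambda>i. x i - of_bool (i \<in> A)) + 1"
proof -
  have "packs \<H> (remove1 A As) (\<lambda>i. x i - of_bool (i \<in> A))"
    unfolding packs_def
  proof (intro conjI allI)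
    show "set (remove1 A As) \<subseteq> \<H>"
      using assms(1) unfolding packs_def by (meson order_trans set_remove1_subset)
    fix i
    have "usage As i \<le> x i" using assms(1) by (simp add: packs_def)
    then show "usage (remove1 A As) i \<le> x i - of_bool (i \<in> A)"
      using usage_remove1[OF assms(3), of i] by simp
  qed
  then have "length (remove1 A As) \<le> height \<H> (\<lambda>i. x i - of_bool (i \<in> A))"
    using le_height_iff by blast
  then show ?thesis using assms(2,3) by (simp add: length_remove1)
qed

lemma height_attained:
  assumes "0 < height \<H> x"
  obtains A where "A \<in> \<H>" "\<And>j. j \<in> A \<Longrightarrow> 0 < x j"
    "height \<H> x \<le> height \<H> (\<lambda>i. x i - of_bool (i \<in> A)) + 1"
proof -
  obtain As where As: "length As = height \<H> x" "packs \<H> As x"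
    using le_height_iff by blast
  then obtain A where A: "A \<in> set As" using assms by (cases As) auto
  show ?thesis
    using that[OF _ _ height_remove_packed[OF As(2,1) A]] packs_positive[OF As(2) A] As(2) A
    by (auto simp: packs_def)
qed

lemma height_move_less:
  assumes "nim_move \<H> x x'"
  shows "height \<H> x' < height \<H> x"
proof -
  obtain A where A: "A \<in> \<H>" "\<And>i. i \<in> A \<Longrightarrow> x' i < x i" "\<And>i. i \<notin> A \<Longrightarrow> x' i = x i"
    using assms unfolding nim_move_def by blast
  have "height \<H> x' + 1 \<le> height \<H> x' + height \<H> (\<lambda>i. of_bool (i \<in> A))"
    using height_ge_pile[OF A(1), of 1] by simp
  also have "\<dots> \<le> height \<H> (\<lambda>i. x' i + of_bool (i \<in> A))" by (rule height_add)
  also have "\<dots> \<le> height \<H> x"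
  proof (rule height_mono)
    fix i show "x' i + of_bool (i \<in> A) \<le> x i" using A(2,3)[of i] by (cases "i \<in> A") auto
  qed
  finally show ?thesis by simp
qed

text \<open>Remove tokens from \<open>b\<close> one at a time; by \<open>height_decrement_le\<close>
  no height is skipped.\<close>

lemma height_intermediate:
  "(\<And>i. a i \<le> b i) \<Longrightarrow> height \<H> a \<le> c \<Longrightarrow> c \<le> height \<H> b \<Longrightarrow>
    \<exists>t. (\<forall>i. a i \<le> t i \<and> t i \<le> b i) \<and> height \<H> t = c"
proof (induction "sum b V" arbitrary: b rule: less_induct)
  case less
  show ?case
  proof (cases "height \<H> b = c")
    case True
    then show ?thesis using less.prems(1) by blast
  next
    case False
    then have lt: "c < height \<H> b" using less.prems(3) by simp
    then obtain j where j: "j \<in> V" "a j < b j"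
      using less.prems(2) height_mono[of b a] by (meson leD leI le_less_trans)
    let ?b = "b(j := b j - 1)"
    have "sum ?b V < sum b V"
      using j finite_V by (intro sum_strict_mono_ex1) auto
    moreover have "a i \<le> ?b i" for i using less.prems(1)[of i] j by auto
    moreover have "c \<le> height \<H> ?b" using height_decrement_le[of b j] lt by linarith
    ultimately obtain t where t: "\<forall>i. a i \<le> t i \<and> t i \<le> ?b i" "height \<H> t = c"
      using less.hyps[of ?b] less.prems(2) by blast
    have "t i \<le> b i" for i using t(1)[rule_format, of i] by (auto split: if_splits)
    then show ?thesis using t by blast
  qed
qed

end

section \<open>The formula for positions\<close>

lemma choose_2_Suc: "Suc y choose 2 = (y choose 2) + y"
  by (simp add: numeral_2_eq_2)

lemma choose_2_mono: "p \<le> y \<Longrightarrow> p choose 2 \<le> y choose 2"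
  unfolding choose_two by (intro div_le_mono mult_le_mono diff_le_mono)

lemma choose_2_gap: "p < y \<Longrightarrow> (p choose 2) + p \<le> y choose 2"
  using choose_2_mono[of "Suc p" y] by (simp add: choose_2_Suc)

text \<open>The intervals of length \<open>p\<close> starting at \<open>p choose 2\<close> tile the
  natural numbers. Since \<open>v_val\<close> lies in the interval of \<open>y_val\<close>, each of
  its values singles out one \<open>y_val\<close>.\<close>

lemma choose_2_block:
  fixes v :: nat
  obtains p where "1 \<le> p" "p choose 2 \<le> v" "v < (p choose 2) + p"
proof -
  have "\<exists>p\<ge>1. p choose 2 \<le> v \<and> v < (p choose 2) + p"
  proof (induction v)
    case 0
    show ?case by (intro exI[of _ 1]) auto
  next
    case (Suc v)
    then obtain p where p: "1 \<le> p" "p choose 2 \<le> v" "v < (p choose 2) + p" by blast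
    show ?case
    proof (cases "Suc v < (p choose 2) + p")
      case True
      then show ?thesis using p by (intro exI[of _ p]) auto
    next
      case False
      then show ?thesis using p by (intro exI[of _ "Suc p"]) (auto simp: choose_2_Suc)
    qed
  qed
  then show ?thesis using that by blast
qed

lemma choose_2_block_unique:
  assumes "p choose 2 \<le> v" "v < (p choose 2) + p" "q choose 2 \<le> v" "v < (q choose 2) + q"
  shows "p = q"
  using choose_2_gap[of p q] choose_2_gap[of q p] assms by (cases p q rule: linorder_cases) auto

lemma y_val_pos: "1 \<le> y_val V \<H> x"
  by (simp add: y_val_def)

lemma v_val_short:
  assumes "y_val V \<H> x choose 2 < min_pile V x"
  shows "v_val V \<H> x = (y_val V \<H> x choose 2) +
    (min_pile V x - (y_val V \<H> x choose 2) - 1) mod y_val V \<H> x"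
proof -
  let ?y = "y_val V \<H> x" and ?m = "min_pile V x"
  have "int ?m - int (?y choose 2) - 1 = int (?m - (?y choose 2) - 1)"
    using assms by simp
  then show ?thesis unfolding v_val_def by (simp only: zmod_int[symmetric] nat_int)
qed

lemma v_val_bounds:
  "y_val V \<H> x choose 2 \<le> v_val V \<H> x"
  "v_val V \<H> x < (y_val V \<H> x choose 2) + y_val V \<H> x"
proof -
  have "(int (min_pile V x) - int (y_val V \<H> x choose 2) - 1) mod int (y_val V \<H> x) < int (y_val V \<H> x)"
    using y_val_pos[of V \<H> x] by (intro pos_mod_bound) linarith
  then show "y_val V \<H> x choose 2 \<le> v_val V \<H> x"
    "v_val V \<H> x < (y_val V \<H> x choose 2) + y_val V \<H> x"
    using y_val_pos[of V \<H> x] by (simp_all add: v_val_def nat_less_iff)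
qed

lemma f_val_long: "min_pile V x \<le> (y_val V \<H> x choose 2) \<Longrightarrow> f_val V \<H> x = height \<H> x"
  and f_val_short: "(y_val V \<H> x choose 2) < min_pile V x \<Longrightarrow> f_val V \<H> x = v_val V \<H> x"
  by (simp_all add: f_val_def)

lemma mex_eqI: "n \<notin> S \<Longrightarrow> (\<And>v. v < n \<Longrightarrow> v \<in> S) \<Longrightarrow> mex S = n"
  unfolding mex_def by (rule Least_equality) (auto simp: not_le[symmetric])

section \<open>Smallest piles, the mex criterion, and why no move preserves
  \<open>f_val\<close>\<close>

context hypergraph
begin

lemma min_pile_le: "i \<in> V \<Longrightarrow> min_pile V x \<le> x i"
  using finite_V by (simp add: min_pile_def)

lemma min_pile_attained:
  assumes "V \<noteq> {}"
  obtains i where "i \<in> V" "x i = min_pile V x"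
proof -
  have "min_pile V x \<in> x ` V"
    unfolding min_pile_def using assms finite_V by (intro Min_in) auto
  then show ?thesis using that by fastforce
qed

lemma min_pile_eqI: "i \<in> V \<Longrightarrow> x i = a \<Longrightarrow> (\<And>j. j \<in> V \<Longrightarrow> a \<le> x j) \<Longrightarrow> min_pile V x = a"
  using finite_V unfolding min_pile_def by (intro Min_eqI) auto

lemma min_pile_move_le:
  assumes "nim_move \<H> x x'"
  shows "min_pile V x' \<le> min_pile V x"
proof (cases "V = {}")
  case False
  then obtain i where i: "i \<in> V" "x i = min_pile V x" by (rule min_pile_attained)
  have "x' i \<le> x i" using assms unfolding nim_move_def by (metis less_imp_le order_refl)
  then show ?thesis using i min_pile_le[OF i(1), of x'] by simp
qed (simp add: min_pile_def)

lemma JM_criterion: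
  assumes no_stay: "\<And>x x'. nim_move \<H> x x' \<Longrightarrow> f_val V \<H> x' \<noteq> f_val V \<H> x"
    and reach: "\<And>x v. v < f_val V \<H> x \<Longrightarrow> \<exists>x'. nim_move \<H> x x' \<and> f_val V \<H> x' = v"
  shows "JM V \<H>"
  unfolding JM_def
proof
  fix x
  show "sprague_grundy \<H> x = f_val V \<H> x"
  proof (induction x rule: wf_induct_rule[OF wf_nim_move[OF finite_V edges]])
    case (1 x)
    have "sprague_grundy \<H> x' = f_val V \<H> x'" if "nim_move \<H> x x'" for x'
      using 1 that by simp
    then have "{sprague_grundy \<H> x' | x'. nim_move \<H> x x'} = {f_val V \<H> x' | x'. nim_move \<H> x x'}"
      by (intro Collect_cong) metis
    moreover have "mex {f_val V \<H> x' | x'. nim_move \<H> x x'} = f_val V \<H> x"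
    proof (rule mex_eqI)
      show "f_val V \<H> x \<notin> {f_val V \<H> x' | x'. nim_move \<H> x x'}"
        using no_stay[of x] by force
      show "v \<in> {f_val V \<H> x' | x'. nim_move \<H> x x'}" if "v < f_val V \<H> x" for v
        using reach[OF that] by auto
    qed
    ultimately show ?case
      using sprague_grundy_rec[OF finite_V edges, of x] by simp
  qed
qed

text \<open>Split off \<open>?m\<close> tokens from every pile: on this constant part two disjoint
  hyperedges can both be played \<open>?m\<close> times, and a packing of the rest adds
  \<open>y_val V \<H> x - 1\<close>.\<close>

lemma height_ge_min_pile:
  assumes "transversal_free \<H>" "A \<in> \<H>"
  shows "y_val V \<H> x - 1 + 2 * min_pile V x \<le> height \<H> x"
proof -
  let ?m = "min_pile V x"
  obtain B where B: "B \<in> \<H>" "A \<inter> B = {}"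
    using assms unfolding transversal_free_def by blast
  have "packs \<H> (replicate ?m A @ replicate ?m B) (\<lambda>i. ?m)"
    using assms(2) B by (auto simp: packs_def)
  then have "2 * ?m \<le> height \<H> (\<lambda>i. ?m)"
    unfolding le_height_iff by (intro exI[of _ "replicate ?m A @ replicate ?m B"]) auto
  then have "y_val V \<H> x - 1 + 2 * ?m \<le> height \<H> (\<lambda>i. x i - ?m) + height \<H> (\<lambda>i. ?m)"
    by (simp add: y_val_def)
  also have "\<dots> \<le> height \<H> (\<lambda>i. (x i - ?m) + ?m)" by (rule height_add)
  also have "\<dots> \<le> height \<H> x" using min_pile_le by (intro height_mono) simp
  finally show ?thesis .
qed

text \<open>Four cases, by the branch of \<open>f_val\<close> that applies before and after the
  move. The hyperedge \<open>B\<close>, disjoint from the moved one, keeps its piles at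
  \<open>?m\<close> or more and so bounds heights after the move from below.\<close>

lemma f_val_move_neq:
  assumes tf: "transversal_free \<H>" and move: "nim_move \<H> x x'"
  shows "f_val V \<H> x' \<noteq> f_val V \<H> x"
proof
  assume eq: "f_val V \<H> x' = f_val V \<H> x"
  let ?m = "min_pile V x" and ?m' = "min_pile V x'"
  let ?y = "y_val V \<H> x" and ?y' = "y_val V \<H> x'"
  obtain A where A: "A \<in> \<H>" "\<And>i. i \<in> A \<Longrightarrow> x' i < x i" "\<And>i. i \<notin> A \<Longrightarrow> x' i = x i"
    using move unfolding nim_move_def by blast
  obtain B where B: "B \<in> \<H>" "A \<inter> B = {}"
    using tf A(1) unfolding transversal_free_def by blast
  have m'_le: "?m' \<le> ?m" by (rule min_pile_move_le[OF move])
  have on_B: "?m \<le> x' i" if "i \<in> B" for i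
  proof -
    have "i \<notin> A" "i \<in> V" using B that edge_subset by blast+
    then show ?thesis using A(3) min_pile_le[of i x] by simp
  qed
  have h_less: "height \<H> x' < height \<H> x" by (rule height_move_less[OF move])
  have v_bound: "v_val V \<H> z \<le> (y_val V \<H> z choose 2) + (y_val V \<H> z - 1)" for z
    using v_val_bounds(2)[where V=V and \<H>=\<H> and x=z] by simp
  show False
  proof (cases "?m \<le> ?y choose 2"; cases "?m' \<le> ?y' choose 2")
    assume "?m \<le> ?y choose 2" "?m' \<le> ?y' choose 2"
    then show False using eq h_less by (simp add: f_val_long)
  next
    \<comment> \<open>The height after the move is at least \<open>?y' - 1 + 2 * ?m'\<close>, which
      exceeds the largest value in the block of \<open>?y'\<close> because
      \<open>?y' choose 2 < ?m'\<close>.\<close>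
    assume long: "?m \<le> ?y choose 2" and short: "\<not> ?m' \<le> ?y' choose 2"
    then have "height \<H> x = v_val V \<H> x'" using eq by (simp add: f_val_def)
    moreover have "?y' - 1 + 2 * ?m' \<le> height \<H> x'" by (rule height_ge_min_pile[OF tf A(1)])
    ultimately show False using v_bound[of x'] h_less short by linarith
  next
    \<comment> \<open>Reducing modulo \<open>?y\<close> can only shrink, so
      \<open>v_val V \<H> x < ?m\<close>, whereas \<open>B\<close> alone still provides
      \<open>?m\<close> moves.\<close>
    assume short: "\<not> ?m \<le> ?y choose 2" and long: "?m' \<le> ?y' choose 2"
    then have h: "height \<H> x' = v_val V \<H> x" using eq by (simp add: f_val_def)
    moreover have "?m \<le> height \<H> x'" using height_ge_pile[OF B(1), of ?m x'] on_B by blast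
    moreover have "v_val V \<H> x \<le> (?y choose 2) + (?m - (?y choose 2) - 1)"
    proof -
      have "v_val V \<H> x = (?y choose 2) + (?m - (?y choose 2) - 1) mod ?y"
        using short by (intro v_val_short) simp
      then show ?thesis using mod_less_eq_dividend by (metis add_left_mono)
    qed
    ultimately show False using short by linarith
  next
    assume "\<not> ?m \<le> ?y choose 2" and "\<not> ?m' \<le> ?y' choose 2"
    then have short: "?y choose 2 < ?m" "?y' choose 2 < ?m'" by simp_all
    then have v_eq: "v_val V \<H> x' = v_val V \<H> x" using eq by (simp add: f_val_short)
    then have y_eq: "?y' = ?y"
      using choose_2_block_unique v_val_bounds by metis
    show False
    \<comment> \<open>If the minimum is kept, the reduced position makes a move as well and
      \<open>?y\<close> would drop. Otherwise \<open>?y\<close> divides \<open>?m - ?m'\<close>, but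
      \<open>B\<close> gives the new reduced position at least that height, so \<open>?y'\<close>
      exceeds \<open>?m - ?m'\<close>.\<close>
    proof (cases "?m' = ?m")
      case True
      have "height \<H> (\<lambda>i. x' i - ?m) < height \<H> (\<lambda>i. x i - ?m)"
      proof (rule height_move_less)
        have "x' i - ?m < x i - ?m" if "i \<in> A" for i
        proof -
          have "i \<in> V" using that edge_subset[OF A(1)] by blast
          then show ?thesis using A(2)[OF that] min_pile_le[of i x'] True by simp
        qed
        then show "nim_move \<H> (\<lambda>i. x i - ?m) (\<lambda>i. x' i - ?m)"
          unfolding nim_move_def using A(1,3) by (intro bexI[of _ A]) auto
      qed
      then show False using y_eq True by (simp add: y_val_def)
    next
      case False
      with m'_le have lt: "?m' < ?m" by simp
      have "(?m - (?y choose 2) - 1) mod ?y = (?m' - (?y choose 2) - 1) mod ?y"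
        using v_eq short y_eq by (simp add: v_val_short)
      then have "?y dvd (?m - (?y choose 2) - 1) - (?m' - (?y choose 2) - 1)"
        using lt short by (intro mod_eq_dvd_iff_nat[THEN iffD1]) auto
      also have "(?m - (?y choose 2) - 1) - (?m' - (?y choose 2) - 1) = ?m - ?m'"
        using lt short y_eq by simp
      finally have "?y \<le> ?m - ?m'" using lt by (intro dvd_imp_le) auto
      also have "?m - ?m' \<le> height \<H> (\<lambda>i. x' i - ?m')"
        using on_B by (intro height_ge_pile[OF B(1)] diff_le_mono)
      finally show False using y_eq by (simp add: y_val_def)
    qed
  qed
qed

end

section \<open>Hypergraphs with single exchanges\<close>

text \<open>Only the target has to lie in \<open>S\<close>: a walk needs positive piles just on the
  hyperedges it enters. The common element is the pile kept empty when switching from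
  \<open>A\<close> to \<open>B\<close>.\<close>

definition exchange :: "'v set set \<Rightarrow> 'v set \<Rightarrow> ('v set \<times> 'v set) set" where
  "exchange \<H> S = {(A, B). A \<in> \<H> \<and> B \<in> \<H> \<and> B \<subseteq> S \<and> card (B - A) \<le> 1 \<and> A \<inter> B \<noteq> {}}"

text \<open>The interface between graphs and the game: \<open>exchange_local\<close> serves walks
  among the positive piles when some pile is empty, \<open>exchange_global\<close> walks when none
  is, and \<open>extension\<close> moves optimal packings onto further piles.\<close>

locale exchange_hypergraph = hypergraph +
  assumes ground_nonempty: "V \<noteq> {}"
    and mtf: "minimal_transversal_free V \<H>"
    and exchange_local: "A \<in> \<H> \<Longrightarrow> B \<in> \<H> \<Longrightarrow> A \<inter> B \<noteq> {} \<Longrightarrow> (A, B) \<in> (exchange \<H> (A \<union> B))\<^sup>*"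
    and exchange_global: "A \<in> \<H> \<Longrightarrow> B \<in> \<H> \<Longrightarrow> (A, B) \<in> (exchange \<H> V)\<^sup>*"
    and extension: "W \<subset> V \<Longrightarrow> W \<noteq> {} \<Longrightarrow>
      \<exists>j\<in>W. \<exists>i\<in>V - W. \<forall>A\<in>\<H>. j \<in> A \<longrightarrow> i \<in> A \<or> (\<exists>A'\<in>\<H>. i \<in> A' \<and> A' \<subseteq> insert i A)"
begin

section \<open>Transversal hyperedges and walks along exchanges\<close>

lemma tf: "transversal_free \<H>"
  using mtf by (simp add: minimal_transversal_free_def)

lemma induced_transversal:
  assumes "S \<subset> V" "A \<in> \<H>" "A \<subseteq> S"
  obtains T where "T \<in> \<H>" "T \<subseteq> S" "\<And>B. B \<in> \<H> \<Longrightarrow> B \<subseteq> S \<Longrightarrow> T \<inter> B \<noteq> {}"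
proof -
  have "induced \<H> S \<noteq> {}" using assms by (auto simp: induced_def)
  then obtain T where "T \<in> induced \<H> S" "\<forall>B\<in>induced \<H> S. T \<inter> B \<noteq> {}"
    using mtf assms(1) unfolding minimal_transversal_free_def by meson
  then show ?thesis using that[of T] by (auto simp: induced_def)
qed

text \<open>If every hyperedge avoided \<open>i\<close>, minimality on \<open>V - {i}\<close> would
  give one that meets all of them, against transversal-freeness.\<close>

lemma edge_through:
  assumes "A \<in> \<H>" "i \<in> V"
  obtains B where "B \<in> \<H>" "i \<in> B"
proof (cases "\<exists>B\<in>\<H>. i \<in> B")
  case False
  then have sub: "B \<subseteq> V - {i}" if "B \<in> \<H>" for B using that edge_subset by blast
  have "V - {i} \<subset> V" using assms(2) by blast
  then obtain T where T: "T \<in> \<H>" "\<And>B. B \<in> \<H> \<Longrightarrow> B \<subseteq> V - {i} \<Longrightarrow> T \<inter> B \<noteq> {}"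
    using induced_transversal[OF _ assms(1) sub[OF assms(1)]] by metis
  obtain B where "B \<in> \<H>" "T \<inter> B = {}" using tf T(1) unfolding transversal_free_def by meson
  then show ?thesis using T(2) sub by blast
qed (use that in blast)

text \<open>Walking along the exchanges, empty the current hyperedge completely, then switch to the next
  one: at most one new pile has to be decreased, by one token, so the height drops by at most one.
  A common pile of consecutive hyperedges stays empty.\<close>

lemma exchange_descent:
  assumes "(A, T) \<in> (exchange \<H> S)\<^sup>*" and pos: "\<And>i. i \<in> S \<Longrightarrow> 0 < z i"
    and "A \<in> \<H>" "\<And>i. i \<in> A \<Longrightarrow> x' i < z i" "\<And>i. i \<notin> A \<Longrightarrow> x' i = z i"
    and "\<exists>j\<in>V. x' j = 0"
    and T: "height \<H> (\<lambda>i. if i \<in> T then 0 else z i) \<le> c" and "c \<le> height \<H> x'"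
  shows "\<exists>x''. nim_move \<H> z x'' \<and> (\<exists>j\<in>V. x'' j = 0) \<and> height \<H> x'' = c"
  using assms(1,3-6,8)
proof (induction A arbitrary: x' rule: converse_rtrancl_induct)
  \<comment> \<open>While \<open>A\<close> is fixed, any position between \<open>x'\<close> and the
    one with \<open>A\<close> emptied is a move on \<open>A\<close> and inherits the empty pile of
    \<open>x'\<close>, so \<open>height_intermediate\<close> applies.\<close>
  have inside: "\<exists>x''. nim_move \<H> z x'' \<and> (\<exists>j\<in>V. x'' j = 0) \<and> height \<H> x'' = c"
    if A: "A \<in> \<H>" "\<And>i. i \<in> A \<Longrightarrow> x' i < z i" "\<And>i. i \<notin> A \<Longrightarrow> x' i = z i" "\<exists>j\<in>V. x' j = 0"
      and c: "c \<le> height \<H> x'" "height \<H> (\<lambda>i. if i \<in> A then 0 else z i) \<le> c" for A x'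
  proof -
    have "\<exists>t. (\<forall>i. (if i \<in> A then 0 else z i) \<le> t i \<and> t i \<le> x' i) \<and> height \<H> t = c"
      using A(3) c by (intro height_intermediate) auto
    then obtain t where t: "\<And>i. (if i \<in> A then 0 else z i) \<le> t i" "\<And>i. t i \<le> x' i" "height \<H> t = c"
      by blast
    have "nim_move \<H> z t"
      unfolding nim_move_def
    proof (intro bexI[OF _ A(1)] conjI ballI allI impI)
      show "t i < z i" if "i \<in> A" for i using t(2)[of i] A(2)[OF that] by simp
      show "t i = z i" if "i \<notin> A" for i using t(1,2)[of i] A(3)[OF that] that by simp
    qed
    moreover have "\<exists>j\<in>V. t j = 0" using A(4) t(2) by (metis le_zero_eq)
    ultimately show ?thesis using t(3) by blast
  qed
  {
    case base
    then show ?case using inside[of T x'] T by blast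
  next
    case (step A B)
    let ?zA = "\<lambda>i. if i \<in> A then 0 else z i"
    show ?case
    proof (cases "height \<H> ?zA \<le> c")
      case True
      then show ?thesis using inside[of A x'] step.prems by blast
    next
      case False
      have B: "B \<in> \<H>" "B \<subseteq> S" "card (B - A) \<le> 1" "A \<inter> B \<noteq> {}"
        using step.hyps(1) by (auto simp: exchange_def)
      let ?z = "\<lambda>i. if i \<in> A \<inter> B then 0 else if i \<in> B then z i - 1 else z i"
      have "finite (B - A)" using edge_subset[OF B(1)] finite_V by (meson finite_Diff finite_subset)
      then obtain v where v: "B - A \<subseteq> {v}"
        using B(3) by (metis card_le_Suc0_iff_eq One_nat_def insert_subset singletonI subsetI subset_singleton_iff)
      \<comment> \<open>\<open>v\<close> is the only pile of \<open>B\<close> outside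
        \<open>A\<close>, or arbitrary if there is none; in both cases taking a token from it leaves
        a position below \<open>?z\<close>.\<close>
      have "height \<H> ?zA \<le> height \<H> (?zA(v := ?zA v - 1)) + 1" by (rule height_decrement_le)
      moreover have "height \<H> (?zA(v := ?zA v - 1)) \<le> height \<H> ?z"
        using v by (intro height_mono) auto
      ultimately have "c \<le> height \<H> ?z" using False by linarith
      moreover have "?z i < z i" if "i \<in> B" for i
        using pos[of i] that B(2) by auto
      moreover have "\<exists>j\<in>V. ?z j = 0" using B(4) edge_subset[OF B(1)] by auto
      ultimately show ?thesis by (intro step.IH[of ?z]) (use B(1) in auto)
    qed
  }
qed

text \<open>The positive piles form a proper subset, so minimality yields among them a hyperedge
  \<open>T\<close> meeting all the others, and emptying it leaves height 0. Taking single tokens on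
  a hyperedge \<open>A\<close> of an optimal packing costs height one; the walk from
  \<open>A\<close> to \<open>T\<close> stays on positive piles.\<close>

lemma descent_with_empty_pile:
  assumes zero: "\<exists>j\<in>V. z j = 0" and c: "c < height \<H> z"
  shows "\<exists>z'. nim_move \<H> z z' \<and> (\<exists>j\<in>V. z' j = 0) \<and> height \<H> z' = c"
proof -
  let ?S = "{i \<in> V. 0 < z i}"
  have S: "?S \<subset> V" using zero by force
  have "0 < height \<H> z" using c by simp
  then obtain A where A: "A \<in> \<H>" "\<And>j. j \<in> A \<Longrightarrow> 0 < z j"
    "height \<H> z \<le> height \<H> (\<lambda>i. z i - of_bool (i \<in> A)) + 1"
    by (rule height_attained) blast
  have AS: "A \<subseteq> ?S" using A(1,2) edge_subset by blast
  obtain T where T: "T \<in> \<H>" "T \<subseteq> ?S" "\<And>B. B \<in> \<H> \<Longrightarrow> B \<subseteq> ?S \<Longrightarrow> T \<inter> B \<noteq> {}"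
    using induced_transversal[OF S A(1) AS] by blast
  have "(A, T) \<in> (exchange \<H> (A \<union> T))\<^sup>*"
    using exchange_local[OF A(1) T(1)] T(3)[OF A(1) AS] by blast
  moreover have "height \<H> (\<lambda>i. if i \<in> T then 0 else z i) = 0"
  proof (rule ccontr)
    assume "height \<H> (\<lambda>i. if i \<in> T then 0 else z i) \<noteq> 0"
    then have "0 < height \<H> (\<lambda>i. if i \<in> T then 0 else z i)" by simp
    then obtain B where B: "B \<in> \<H>" "\<And>j. j \<in> B \<Longrightarrow> 0 < (if j \<in> T then 0 else z j)"
      by (rule height_attained) blast
    have "0 < z j \<and> j \<notin> T" if "j \<in> B" for j using B(2)[OF that] by (auto split: if_splits)
    then have "B \<subseteq> ?S" "T \<inter> B = {}" using edge_subset[OF B(1)] by blast+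
    then show False using T(3)[OF B(1)] by blast
  qed
  ultimately show ?thesis
    using A AS T(2) zero c
    by (intro exchange_descent[of A T "A \<union> T" z "\<lambda>i. z i - of_bool (i \<in> A)"]) auto
qed

text \<open>\<open>C\<close> makes the hypergraph induced on \<open>V - {i}\<close> nonempty, so it
  has a hyperedge \<open>T\<close> meeting all the others there. Once \<open>T\<close> is emptied,
  every playable hyperedge contains \<open>i\<close>, which bounds the height by
  \<open>z i\<close>.\<close>

lemma descent_to_pile:
  assumes pos: "\<And>j. j \<in> V \<Longrightarrow> 0 < z j" and i: "i \<in> V" and C: "C \<in> \<H>" "i \<notin> C"
    and A: "A \<in> \<H>" "\<And>j. j \<in> A \<Longrightarrow> x' j < z j" "\<And>j. j \<notin> A \<Longrightarrow> x' j = z j" "\<exists>j\<in>V. x' j = 0"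
    and c: "z i \<le> c" "c \<le> height \<H> x'"
  shows "\<exists>x''. nim_move \<H> z x'' \<and> (\<exists>j\<in>V. x'' j = 0) \<and> height \<H> x'' = c"
proof -
  have "V - {i} \<subset> V" "C \<subseteq> V - {i}" using i C(2) edge_subset[OF C(1)] by auto
  obtain T where T: "T \<in> \<H>" "T \<subseteq> V - {i}" "\<And>B. B \<in> \<H> \<Longrightarrow> B \<subseteq> V - {i} \<Longrightarrow> T \<inter> B \<noteq> {}"
    using induced_transversal[OF \<open>V - {i} \<subset> V\<close> C(1) \<open>C \<subseteq> V - {i}\<close>] by metis
  let ?zT = "\<lambda>j. if j \<in> T then 0 else z j"
  have "height \<H> ?zT \<le> ?zT i"
  proof (rule height_le_pile)
    fix B assume B: "B \<in> \<H>" "\<And>j. j \<in> B \<Longrightarrow> 0 < ?zT j"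
    have "T \<inter> B = {}" using B(2) by fastforce
    then show "i \<in> B" using T(3)[OF B(1)] edge_subset[OF B(1)] by blast
  qed
  also have "?zT i \<le> c" using T(2) c(1) by auto
  finally have T_le: "height \<H> ?zT \<le> c" .
  show ?thesis
    by (rule exchange_descent[where x' = x', OF exchange_global[OF A(1) T(1)]])
      (fact pos A T_le c)+
qed

section \<open>Positions with prescribed minimum and prescribed \<open>y_val\<close>\<close>

lemma lift_move:
  assumes a: "a \<le> min_pile V x" and move: "nim_move \<H> (\<lambda>i. x i - a) z'"
    and zero: "\<exists>j\<in>V. z' j = 0"
  shows "\<exists>x'. nim_move \<H> x x' \<and> min_pile V x' = a \<and> y_val V \<H> x' = height \<H> z' + 1"
proof -
  obtain A where A: "A \<in> \<H>" "\<And>i. i \<in> A \<Longrightarrow> z' i < x i - a" "\<And>i. i \<notin> A \<Longrightarrow> z' i = x i - a"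
    using move unfolding nim_move_def by blast
  \<comment> \<open>Outside \<open>V\<close> the difference \<open>x i - a\<close> may be truncated,
    so the original value is kept there.\<close>
  let ?x = "\<lambda>i. if i \<in> V then z' i + a else x i"
  have le: "a \<le> x i" if "i \<in> V" for i using a min_pile_le[OF that, of x] by simp
  have "nim_move \<H> x ?x"
    unfolding nim_move_def
  proof (intro bexI[OF _ A(1)] conjI ballI allI impI)
    show "?x i < x i" if "i \<in> A" for i using A(2)[OF that] edge_subset[OF A(1)] that by auto
    show "?x i = x i" if "i \<notin> A" for i using A(3)[OF that] le[of i] by auto
  qed
  moreover have m: "min_pile V ?x = a"
    using zero by (auto intro: min_pile_eqI)
  moreover have "height \<H> (\<lambda>i. ?x i - a) = height \<H> z'"
    by (rule height_cong) simp
  ultimately show ?thesis by (intro exI[of _ ?x]) (simp add: y_val_def)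
qed

text \<open>Work with all piles reduced by \<open>a\<close>: an empty pile then fixes the minimum,
  and height \<open>p - 1\<close> fixes \<open>y_val\<close>. For \<open>a < ?m\<close>, emptying
  the smallest pile \<open>i\<close> and taking one token elsewhere in \<open>A\<close> leaves at
  least \<open>x i - ?m\<close> on each pile, hence enough height; \<open>?m - a < p\<close> is the
  bound required to descend to pile \<open>i\<close>.\<close>

lemma reach_y_val:
  assumes "a \<le> min_pile V x" "min_pile V x - a < p" "p \<le> y_val V \<H> x"
    and "a = min_pile V x \<Longrightarrow> p < y_val V \<H> x"
  shows "\<exists>x'. nim_move \<H> x x' \<and> min_pile V x' = a \<and> y_val V \<H> x' = p"
proof -
  let ?m = "min_pile V x"
  let ?z = "\<lambda>i. x i - a"
  obtain i where i: "i \<in> V" "x i = ?m" using min_pile_attained[OF ground_nonempty] by blast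
  have "\<exists>z'. nim_move \<H> ?z z' \<and> (\<exists>j\<in>V. z' j = 0) \<and> height \<H> z' = p - 1"
  proof (cases "a = ?m")
    case True
    have "p - 1 < height \<H> ?z" using True assms(2,4) by (simp add: y_val_def)
    moreover have "\<exists>j\<in>V. ?z j = 0" using i True by (intro bexI[of _ i]) auto
    ultimately show ?thesis by (intro descent_with_empty_pile)
  next
    case False
    then have lt: "a < ?m" using assms(1) by simp
    let ?w = "\<lambda>i. x i - ?m"
    have hw: "p - 1 \<le> height \<H> ?w" using assms(3) by (simp add: y_val_def)
    have "0 < height \<H> ?w" using hw assms(2) lt by linarith
    then obtain C where C: "C \<in> \<H>" "\<And>j. j \<in> C \<Longrightarrow> 0 < ?w j"
      by (rule height_attained) blast
    have iC: "i \<notin> C" using C(2)[of i] i by auto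
    obtain A where A: "A \<in> \<H>" "i \<in> A" using edge_through[OF C(1) i(1)] by blast
    let ?x' = "\<lambda>j. if j = i then 0 else ?z j - of_bool (j \<in> A)"
    have ge: "?m \<le> x j" if "j \<in> V" for j by (rule min_pile_le[OF that])
    have "height \<H> ?w \<le> height \<H> ?x'"
      using i lt by (intro height_mono) auto
    then have "p - 1 \<le> height \<H> ?x'" using hw by simp
    moreover have "?x' j < ?z j" if "j \<in> A" for j
      using ge[of j] lt that edge_subset[OF A(1)] by auto
    moreover have "?x' j = ?z j" if "j \<notin> A" for j using that A(2) by auto
    moreover have "0 < ?z j" if "j \<in> V" for j using ge[OF that] lt by simp
    ultimately show ?thesis
      using i assms(2) by (intro descent_to_pile[of ?z i C A ?x'] i(1) C(1) iC A(1)) auto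
  qed
  then show ?thesis using lift_move[OF assms(1)] assms(2) by fastforce
qed

text \<open>With \<open>v\<close> in the block of \<open>p\<close>, aim for \<open>y_val\<close>
  equal to \<open>p\<close> and a minimum above \<open>p choose 2\<close> in the right residue
  class, so that the second branch of \<open>f_val\<close> yields \<open>v\<close>.\<close>

lemma reach_small_value:
  assumes "v < min_pile V x" "v < (y_val V \<H> x choose 2)"
  shows "\<exists>x'. nim_move \<H> x x' \<and> f_val V \<H> x' = v"
proof -
  let ?m = "min_pile V x" and ?y = "y_val V \<H> x"
  obtain p where p: "1 \<le> p" "p choose 2 \<le> v" "v < (p choose 2) + p" by (rule choose_2_block)
  have "p < ?y" using choose_2_mono[of ?y p] p assms(2) by (meson not_le le_trans)
  \<comment> \<open>The least decrease that makes the minimum congruent to \<open>v + 1\<close>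
    modulo \<open>p\<close>. It is below \<open>p\<close>; for \<open>d = 0\<close>,
    \<open>reach_y_val\<close> also needs \<open>p < ?y\<close>.\<close>
  define d where "d = (?m - 1 - v) mod p"
  define q where "q = (?m - 1 - v) div p"
  have d: "d < p" "?m = v + 1 + q * p + d"
    using p(1) assms(1) by (simp_all add: d_def q_def)
  obtain x' where x': "nim_move \<H> x x'" "min_pile V x' = ?m - d" "y_val V \<H> x' = p"
    using reach_y_val[of "?m - d" x p] d \<open>p < ?y\<close> by auto
  have "?m - d - (p choose 2) - 1 = (v - (p choose 2)) + q * p"
    using d(2) p(2) by simp
  moreover have "((v - (p choose 2)) + q * p) mod p = v - (p choose 2)"
    using p by (simp del: add_diff_assoc2)
  ultimately have "(?m - d - (p choose 2) - 1) mod p = v - (p choose 2)"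
    by simp
  moreover have short: "p choose 2 < ?m - d" using d(2) p(2) by simp
  ultimately have "v_val V \<H> x' = v"
    using x' p(2) v_val_short[of V \<H> x'] by simp
  then show ?thesis using short using x' by (intro exI[of _ x']) (simp add: f_val_short)
qed

text \<open>Within the block of \<open>y_val\<close>, keep \<open>y_val\<close> and lower the
  minimum by the wanted decrease \<open>d\<close>: it is at most the residue \<open>r\<close>, so
  the residue does not wrap around.\<close>

lemma reach_from_short:
  assumes short: "(y_val V \<H> x choose 2) < min_pile V x" and v: "v < v_val V \<H> x"
  shows "\<exists>x'. nim_move \<H> x x' \<and> f_val V \<H> x' = v"
proof (cases "v < (y_val V \<H> x choose 2)")
  case True
  then show ?thesis using reach_small_value short by simp
next
  case False
  let ?m = "min_pile V x" and ?y = "y_val V \<H> x"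
  define r where "r = (?m - (?y choose 2) - 1) mod ?y"
  define q where "q = (?m - (?y choose 2) - 1) div ?y"
  have vv: "v_val V \<H> x = (?y choose 2) + r" using v_val_short[OF short] by (simp add: r_def)
  have r: "r < ?y" using y_val_pos[of V \<H> x] by (simp add: r_def)
  have m: "?m = (?y choose 2) + 1 + (q * ?y + r)"
    using short unfolding q_def r_def div_mult_mod_eq by simp
  define d where "d = v_val V \<H> x - v"
  have d: "0 < d" "d \<le> r" using v False vv by (auto simp: d_def)
  obtain x' where x': "nim_move \<H> x x'" "min_pile V x' = ?m - d" "y_val V \<H> x' = ?y"
  proof -
    have "?m - d < ?m" "?m - (?m - d) < ?y" using d r m by linarith+
    then show ?thesis using reach_y_val[of "?m - d" x ?y] that by auto
  qed
  have "?m - d - (?y choose 2) - 1 = (r - d) + q * ?y" using m d by simp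
  then have "(?m - d - (?y choose 2) - 1) mod ?y = r - d"
    using r by simp
  moreover have short': "?y choose 2 < ?m - d" using m d by linarith
  ultimately have "v_val V \<H> x' = (?y choose 2) + (r - d)"
    using x' v_val_short[of V \<H> x'] by simp
  also have "\<dots> = v" using d vv v unfolding d_def by linarith
  finally show ?thesis using x' short' by (intro exI[of _ x']) (simp add: f_val_short)
qed

text \<open>The piles used by optimal packings form a nonempty set that is closed in the sense of
  \<open>extension\<close>: otherwise exchange the hyperedge through \<open>j\<close> in the packing.\<close>

lemma optimal_edge_through:
  assumes pos: "\<And>j. j \<in> V \<Longrightarrow> 0 < x j" and h: "0 < height \<H> x" and i: "i \<in> V"
  obtains A where "A \<in> \<H>" "i \<in> A" "height \<H> x \<le> height \<H> (\<lambda>k. x k - of_bool (k \<in> A)) + 1"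
proof -
  define W where
    "W = {j. \<exists>As A. packs \<H> As x \<and> length As = height \<H> x \<and> A \<in> set As \<and> j \<in> A}"
  have W_I: "j \<in> W" if "packs \<H> As x" "length As = height \<H> x" "A \<in> set As" "j \<in> A" for As A j
    using that unfolding W_def by blast
  have "W \<subseteq> V" using edge_subset by (auto simp: W_def packs_def)
  obtain As where As: "length As = height \<H> x" "packs \<H> As x" using le_height_iff by blast
  then obtain A where A: "A \<in> set As" using h by (cases As) auto
  then have "A \<in> \<H>" using As(2) by (auto simp: packs_def)
  then have "A \<noteq> {}" by (rule edge_nonempty)
  then have "W \<noteq> {}" using W_I[OF As(2,1) A] by blast
  have "W = V"
  proof (rule ccontr)
    assume "W \<noteq> V"
    then have "W \<subset> V" using \<open>W \<subseteq> V\<close> by blast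
    from extension[OF this \<open>W \<noteq> {}\<close>] obtain j i where ji: "j \<in> W" "i \<in> V - W" and
      ext: "\<forall>A\<in>\<H>. j \<in> A \<longrightarrow> i \<in> A \<or> (\<exists>A'\<in>\<H>. i \<in> A' \<and> A' \<subseteq> insert i A)"
      by (elim bexE)
    obtain As A where As: "packs \<H> As x" "length As = height \<H> x" "A \<in> set As" "j \<in> A"
      using ji(1) by (auto simp: W_def)
    \<comment> \<open>No optimal packing uses \<open>i\<close>, so its positive pile has room for
      the single hyperedge \<open>A'\<close>; on the other piles \<open>A'\<close> uses no more than
      \<open>A\<close> did.\<close>
    have unused: "usage As i = 0" using W_I[OF As(1,2)] ji(2) by (auto simp: usage_eq_0_iff)
    then have "i \<notin> A" using As(3) by (auto simp: usage_eq_0_iff)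
    moreover have "A \<in> \<H>" using As by (auto simp: packs_def)
    ultimately obtain A' where A': "A' \<in> \<H>" "i \<in> A'" "A' \<subseteq> insert i A"
      using ext As(4) by blast
    let ?Bs = "A' # remove1 A As"
    have "usage ?Bs k \<le> x k" for k
    proof (cases "k = i")
      case True
      then show ?thesis
        using unused usage_remove1[OF As(3), of i] pos[of i] ji(2) A'(2) by simp
    next
      case False
      then have "usage ?Bs k \<le> usage As k"
        using A'(3) usage_remove1[OF As(3), of k] by auto
      also have "\<dots> \<le> x k" using As(1) by (simp add: packs_def)
      finally show ?thesis .
    qed
    moreover have "set ?Bs \<subseteq> \<H>"
      using As(1) A'(1) set_remove1_subset[of A As] by (auto simp: packs_def)
    ultimately have "packs \<H> ?Bs x" by (simp add: packs_def)
    moreover have "length ?Bs = height \<H> x"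
      using As(2,3) length_pos_if_in_set[OF As(3)] by (simp add: length_remove1)
    ultimately have "i \<in> W" using A'(2) W_I[of ?Bs A' i] by simp
    then show False using ji(2) by blast
  qed
  then obtain As A where As: "packs \<H> As x" "length As = height \<H> x" "A \<in> set As" "i \<in> A"
    using i by (auto simp: W_def)
  moreover have "A \<in> \<H>" using As(1,3) by (auto simp: packs_def)
  ultimately show ?thesis using that height_remove_packed by blast
qed

lemma reach_from_long:
  assumes long: "min_pile V x \<le> (y_val V \<H> x choose 2)" and v: "v < height \<H> x"
  shows "\<exists>x'. nim_move \<H> x x' \<and> f_val V \<H> x' = v"
proof -
  let ?m = "min_pile V x" and ?y = "y_val V \<H> x"
  obtain i where i: "i \<in> V" "x i = ?m" using min_pile_attained[OF ground_nonempty] by blast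
  have f_zero: "f_val V \<H> x' = height \<H> x'" if "\<exists>j\<in>V. x' j = 0" for x'
  proof (rule f_val_long)
    from that obtain j where "j \<in> V" "x' j = 0" by blast
    then have "min_pile V x' = 0" by (rule min_pile_eqI) simp
    then show "min_pile V x' \<le> (y_val V \<H> x' choose 2)" by simp
  qed
  consider "?m = 0" | "v < ?m" | "0 < ?m" "?m \<le> v" by linarith
  then show ?thesis
  proof cases
    case 1
    then have "\<exists>j\<in>V. x j = 0" using i by auto
    then show ?thesis using descent_with_empty_pile[OF _ v] f_zero by metis
  next
    case 2
    then show ?thesis using reach_small_value long by simp
  next
    case 3
    have ge: "?m \<le> x j" if "j \<in> V" for j by (rule min_pile_le[OF that])
    have pos: "0 < x j" if "j \<in> V" for j using ge[OF that] 3 by simp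
    \<comment> \<open>For \<open>?y = 1\<close> the binomial vanishes, contradicting
      \<open>0 < ?m\<close>. Positive reduced height provides a hyperedge \<open>C\<close> avoiding
      \<open>i\<close>.\<close>
    have "0 < height \<H> (\<lambda>i. x i - ?m)"
    proof (rule ccontr)
      assume "\<not> 0 < height \<H> (\<lambda>i. x i - ?m)"
      then have "?y = 1" by (simp add: y_val_def)
      then show False using 3 long by (simp add: binomial_eq_0)
    qed
    then obtain C where C: "C \<in> \<H>" "\<And>j. j \<in> C \<Longrightarrow> 0 < x j - ?m"
      by (rule height_attained) blast
    have iC: "i \<notin> C" using C(2)[of i] i by auto
    have "0 < height \<H> x" using v by simp
    then obtain A where A: "A \<in> \<H>" "i \<in> A"
      "height \<H> x \<le> height \<H> (\<lambda>k. x k - of_bool (k \<in> A)) + 1"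
      using optimal_edge_through[of x i, OF pos _ i(1)] by blast
    \<comment> \<open>\<open>?b\<close> has height at least \<open>height \<H> x - 1\<close>, and
      \<open>?a\<close> in addition empties \<open>i\<close>. Values up to the height of
      \<open>?a\<close> come from walks with an empty pile, the remaining ones from varying pile
      \<open>i\<close> only.\<close>
    let ?b = "\<lambda>k. x k - of_bool (k \<in> A)"
    let ?a = "\<lambda>k. if k = i then 0 else ?b k"
    have posA: "0 < x k" if "k \<in> A" for k using pos that edge_subset[OF A(1)] by auto
    show ?thesis
    proof (cases "v \<le> height \<H> ?a")
      case True
      have "\<exists>x''. nim_move \<H> x x'' \<and> (\<exists>j\<in>V. x'' j = 0) \<and> height \<H> x'' = v"
        using i 3 A(2) posA True
        by (intro descent_to_pile[of x i C A ?a] pos i(1) C(1) iC A(1)) auto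
      then show ?thesis using f_zero by metis
    next
      case False
      have "\<exists>t. (\<forall>k. ?a k \<le> t k \<and> t k \<le> ?b k) \<and> height \<H> t = v"
      proof (rule height_intermediate)
        show "height \<H> ?a \<le> v" using False by simp
        show "v \<le> height \<H> ?b" using A(3) v by linarith
      qed simp
      then obtain t where t: "\<And>k. ?a k \<le> t k" "\<And>k. t k \<le> ?b k" "height \<H> t = v" by blast
      \<comment> \<open>Other piles lose at most one token and \<open>i\<close> at least one, so
        \<open>i\<close> stays smallest, the minimum falls and \<open>y_val\<close> does not
        decrease: the first branch of \<open>f_val\<close> still applies.\<close>
      have t_eq: "t k = ?b k" if "k \<noteq> i" for k
        using t(1)[of k] t(2)[of k] that by simp
      have ti: "t i \<le> ?m - 1" using t(2)[of i] A(2) i by simp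
      have "nim_move \<H> x t"
        unfolding nim_move_def
      proof (intro bexI[OF _ A(1)] conjI ballI allI impI)
        show "t k < x k" if "k \<in> A" for k using t(2)[of k] posA[OF that] that by simp
        show "t k = x k" if "k \<notin> A" for k using t_eq[of k] A(2) that by auto
      qed
      moreover have min_t: "min_pile V t = t i"
      proof (rule min_pile_eqI[OF i(1) refl])
        fix k assume "k \<in> V"
        then show "t i \<le> t k" using ge[of k] ti t_eq[of k] by (cases "k = i") auto
      qed
      moreover have "?y \<le> y_val V \<H> t"
        unfolding y_val_def min_t
      proof (intro add_right_mono height_mono)
        fix k assume "k \<in> V"
        then show "x k - ?m \<le> t k - t i"
          using ge[of k] ti t_eq[of k] i 3(1) by (cases "k = i") auto
      qed
      then have "?y choose 2 \<le> y_val V \<H> t choose 2" by (rule choose_2_mono)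
      then have "min_pile V t \<le> y_val V \<H> t choose 2" using long ti min_t by linarith
      ultimately show ?thesis using t(3) f_val_long by metis
    qed
  qed
qed

theorem JM_exchange_hypergraph: "JM V \<H>"
proof (rule JM_criterion)
  show "f_val V \<H> x' \<noteq> f_val V \<H> x" if "nim_move \<H> x x'" for x x'
    by (rule f_val_move_neq[OF tf that])
  show "\<exists>x'. nim_move \<H> x x' \<and> f_val V \<H> x' = v" if "v < f_val V \<H> x" for x v
  proof (cases "min_pile V x \<le> (y_val V \<H> x choose 2)")
    case True
    then show ?thesis using reach_from_long that by (simp add: f_val_long)
  next
    case False
    then show ?thesis using reach_from_short that by (simp add: f_val_short)
  qed
qed

end

section \<open>Growing connected edge sets and trees\<close>

lemma incident_vertices_simps [simp]:
  "incident_vertices {} = {}"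
  "incident_vertices (insert e F) = e \<union> incident_vertices F"
  "incident_vertices (F \<union> F') = incident_vertices F \<union> incident_vertices F'"
  by (auto simp: incident_vertices_def)

lemma incident_vertices_mono: "F \<subseteq> F' \<Longrightarrow> incident_vertices F \<subseteq> incident_vertices F'"
  by (auto simp: incident_vertices_def)

lemma subset_incident_vertices: "e \<in> F \<Longrightarrow> e \<subseteq> incident_vertices F"
  by (auto simp: incident_vertices_def)

text \<open>For \<open>t = True\<close> these are the edge sets of trees, for \<open>t = False\<close> the finite connected edge
  sets.\<close>

inductive grown :: "bool \<Rightarrow> 'a set set \<Rightarrow> bool" for t where
  single: "card e = 2 \<Longrightarrow> grown t {e}"
| add: "grown t F \<Longrightarrow> e \<notin> F \<Longrightarrow> card e = 2 \<Longrightarrow> e \<inter> incident_vertices F \<noteq> {} \<Longrightarrow>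
    (t \<Longrightarrow> \<not> e \<subseteq> incident_vertices F) \<Longrightarrow> grown t (insert e F)"

lemma grown_connected: "grown t F \<Longrightarrow> grown False F"
  by (induction rule: grown.induct) (auto intro: grown.intros)

lemma grown_finite: "grown t F \<Longrightarrow> finite F"
  and grown_nonempty: "grown t F \<Longrightarrow> F \<noteq> {}"
  and grown_card_edge: "grown t F \<Longrightarrow> e \<in> F \<Longrightarrow> card e = 2"
  by (induction rule: grown.induct) auto

lemma card_2_finite: "card e = 2 \<Longrightarrow> finite e"
  by (rule card_ge_0_finite) simp

lemma card_2_Un:
  assumes "card e = 2" "e \<inter> W \<noteq> {}" "\<not> e \<subseteq> W"
  obtains u w where "e = {u, w}" "u \<in> W" "w \<notin> W"
  using assms by (auto simp: card_2_iff)

lemma grown_finite_vertices: "grown t F \<Longrightarrow> finite (incident_vertices F)"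
  by (induction rule: grown.induct) (auto simp: card_2_finite)

lemma card_vertices_tree: "grown True F \<Longrightarrow> card (incident_vertices F) = card F + 1"
proof (induction rule: grown.induct)
  case (add F e)
  obtain u w where uw: "e = {u, w}" "u \<in> incident_vertices F" "w \<notin> incident_vertices F"
    using card_2_Un add.hyps by metis
  then have "e \<union> incident_vertices F = insert w (incident_vertices F)" by auto
  then show ?case
    using add uw(3) grown_finite_vertices[OF add.hyps(1)] grown_finite[OF add.hyps(1)] by simp
qed simp

text \<open>Connectedness in terms of edges. Either the last edge \<open>e\<close> is all of
  \<open>M\<close>, or \<open>M\<close> splits \<open>F\<close> and induction applies, or
  \<open>M = F\<close> and \<open>e\<close> itself touches it.\<close>

lemma ex_touching_edge:
  "grown t D \<Longrightarrow> M \<noteq> {} \<Longrightarrow> M \<subset> D \<Longrightarrow> \<exists>g\<in>D - M. g \<inter> incident_vertices M \<noteq> {}"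
proof (induction arbitrary: M rule: grown.induct)
  case (single e)
  then show ?case by auto
next
  case (add F e)
  consider "M \<inter> F = {}" | "M \<inter> F \<noteq> {}" "M \<inter> F \<subset> F" | "F \<subseteq> M" by blast
  then show ?case
  proof cases
    case 1
    then have M: "M = {e}" using add.prems by blast
    obtain f where "f \<in> F" "e \<inter> f \<noteq> {}"
      using add.hyps(4) by (auto simp: incident_vertices_def)
    then show ?thesis using M add.hyps(2) by (intro bexI[of _ f]) auto
  next
    case 2
    from add.IH[OF this] obtain g where "g \<in> F - M \<inter> F" "g \<inter> incident_vertices (M \<inter> F) \<noteq> {}"
      by (elim bexE)
    then show ?thesis using incident_vertices_mono[of "M \<inter> F" M] by (intro bexI[of _ g]) auto
  next
    case 3
    then have "M = F" using add.prems(2) by auto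
    then show ?thesis using add.hyps(2,4) by auto
  qed
qed

lemma ex_leaving_edge:
  assumes "grown t D" "M \<noteq> {}" "M \<subseteq> D" "incident_vertices M \<noteq> incident_vertices D"
  shows "\<exists>g\<in>D - M. g \<inter> incident_vertices M \<noteq> {} \<and> \<not> g \<subseteq> incident_vertices M"
proof -
  \<comment> \<open>Saturate \<open>M\<close> by all edges of \<open>D\<close> inside its vertex
    set; an edge touching the saturated set from outside must have an end elsewhere.\<close>
  let ?M = "{g \<in> D. g \<subseteq> incident_vertices M}"
  have M: "M \<subseteq> ?M" using assms(3) by (auto simp: incident_vertices_def)
  then have eq: "incident_vertices ?M = incident_vertices M"
    by (auto simp: incident_vertices_def)
  then have "?M \<subset> D" using assms(4) by fastforce
  moreover have "?M \<noteq> {}" using assms(2) M by blast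
  ultimately obtain g where "g \<in> D - ?M" "g \<inter> incident_vertices ?M \<noteq> {}"
    using ex_touching_edge[OF assms(1), of ?M] by meson
  then show ?thesis using M eq by (intro bexI[of _ g]) auto
qed

text \<open>A connected set accepts any touching edge, but a tree needs an edge to a new vertex.
  \<open>room\<close> says that the \<open>card M + 1\<close> vertices of a tree \<open>M\<close> do
  not exhaust those of \<open>D\<close>.\<close>

lemma grown_extend:
  assumes D: "grown False D" and M: "grown t M" "M \<subset> D"
    and room: "t \<Longrightarrow> card M + 1 < card (incident_vertices D)"
  shows "\<exists>g\<in>D - M. grown t (insert g M)"
proof (cases t)
  case True
  then have "incident_vertices M \<noteq> incident_vertices D"
    using room card_vertices_tree[of M] M(1) by auto
  then obtain g where "g \<in> D - M" "g \<inter> incident_vertices M \<noteq> {}" "\<not> g \<subseteq> incident_vertices M"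
    using ex_leaving_edge[OF D grown_nonempty[OF M(1)]] M(2) by blast
  then show ?thesis using M(1) grown_card_edge[OF D] by (intro bexI[of _ g] grown.add) auto
next
  case False
  obtain g where "g \<in> D - M" "g \<inter> incident_vertices M \<noteq> {}"
    using ex_touching_edge[OF D grown_nonempty[OF M(1)] M(2)] by blast
  then show ?thesis using M(1) grown_card_edge[OF D] False by (intro bexI[of _ g] grown.add) auto
qed

lemma grown_extend_to_card:
  assumes D: "grown False D" and "grown t C" "C \<subseteq> D" "card C \<le> n" "n \<le> card D"
    and room: "t \<Longrightarrow> n < card (incident_vertices D)"
  shows "\<exists>M. grown t M \<and> C \<subseteq> M \<and> M \<subseteq> D \<and> card M = n"
  using assms(2-4)
proof (induction "n - card C" arbitrary: C)
  case 0
  then show ?case by (intro exI[of _ C]) auto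
next
  case (Suc l)
  then have lt: "card C < n" by simp
  then have "C \<subset> D" using Suc.prems assms(5) by auto
  then obtain g where g: "g \<in> D - C" "grown t (insert g C)"
  proof -
    have "card C + 1 < card (incident_vertices D)" if t using room[OF that] lt by linarith
    then show ?thesis using grown_extend[OF D Suc.prems(1) \<open>C \<subset> D\<close>] that by blast
  qed
  have "card (insert g C) = Suc (card C)" using g(1) grown_finite[OF Suc.prems(1)] by simp
  then have "l = n - card (insert g C)" "card (insert g C) \<le> n" "insert g C \<subseteq> D"
    using Suc.hyps(2) lt g(1) Suc.prems(2) by auto
  then show ?case using Suc.hyps(1)[OF _ g(2)] by blast
qed

text \<open>A largest grown subset of \<open>insert e F\<close> containing \<open>insert e C\<close> and having at most \<open>card F\<close>
  elements misses exactly one edge.\<close>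

lemma grown_exchange:
  assumes F: "grown t F" and C: "C \<subseteq> F" "card C < card F" "grown t (insert e C)"
    and e: "e \<notin> F" "e \<inter> incident_vertices F \<noteq> {}"
  shows "\<exists>f\<in>F - C. grown t (insert e F - {f})"
proof -
  have fin: "finite F" by (rule grown_finite[OF F])
  have D: "grown False (insert e F)"
    using grown_connected[OF F] e grown_card_edge[OF C(3)] by (intro grown.add) auto
  have cardD: "card (insert e F) = Suc (card F)" using fin e(1) by simp
  have "card (insert e C) \<le> card F"
    using C(1,2) fin e(1) finite_subset[OF C(1) fin] by (subst card_insert_disjoint) auto
  moreover have "card F < card (incident_vertices (insert e F))" if t
  proof -
    have "card F < card (incident_vertices F)" using card_vertices_tree[of F] F that by simp
    also have "\<dots> \<le> card (incident_vertices (insert e F))"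
      by (intro card_mono grown_finite_vertices[OF D] incident_vertices_mono) auto
    finally show ?thesis .
  qed
  ultimately obtain M where M: "grown t M" "insert e C \<subseteq> M" "M \<subseteq> insert e F" "card M = card F"
    using grown_extend_to_card[OF D C(3), of "card F"] C(1) cardD by auto
  have "card (insert e F - M) = 1"
    using M(3,4) cardD grown_finite[OF M(1)] by (simp add: card_Diff_subset)
  then obtain f where f: "insert e F - M = {f}" by (auto simp: card_1_singleton_iff)
  then have "M = insert e F - {f}" using M(3) by (metis double_diff subset_refl)
  moreover have "f \<in> insert e F - M" using f by simp
  then have "f \<in> F - C" using M(2) by blast
  ultimately show ?thesis using M(1) by blast
qed

lemma grown_single_exchange:
  assumes F: "grown t F" and e: "card e = 2" "e \<notin> F" "e \<inter> incident_vertices F \<noteq> {}"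
  shows "\<exists>f\<in>F. grown t (insert e F - {f})"
proof -
  have "card {} < card F" using grown_nonempty[OF F] grown_finite[OF F] by (simp add: card_gt_0_iff)
  then show ?thesis
    using grown_exchange[OF F empty_subsetI _ grown.single[OF e(1)] e(2,3)] by simp
qed

text \<open>That \<open>e\<close> touches \<open>F\<close> ensures that the vertex set gains at most
  one vertex and that old and new vertex sets overlap.\<close>

definition grown_step :: "bool \<Rightarrow> nat \<Rightarrow> 'a set set \<Rightarrow> ('a set set \<times> 'a set set) set" where
  "grown_step t k D = {(F, F'). F \<subseteq> D \<and> F' \<subseteq> D \<and> card F = k \<and> card F' = k \<and> grown t F \<and> grown t F' \<and>
     (\<exists>e f. F' = insert e F - {f} \<and> e \<notin> F \<and> f \<in> F \<and> e \<inter> incident_vertices F \<noteq> {})}"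

lemma grown_stepI:
  assumes "F \<subseteq> D" "card F = k" "grown t F" "e \<in> D" "e \<notin> F" "f \<in> F"
    "e \<inter> incident_vertices F \<noteq> {}" "grown t (insert e F - {f})"
  shows "(F, insert e F - {f}) \<in> grown_step t k D"
proof -
  have "card (insert e F - {f}) = k"
    using assms(2,5,6) grown_finite[OF assms(3)] by (subst card_Diff_singleton) auto
  then show ?thesis using assms unfolding grown_step_def by blast
qed

lemma grown_steps_invariant:
  "(F, F') \<in> (grown_step t k D)\<^sup>* \<Longrightarrow> F \<subseteq> D \<Longrightarrow> card F = k \<Longrightarrow> grown t F \<Longrightarrow>
    F' \<subseteq> D \<and> card F' = k \<and> grown t F'"
  by (induction rule: rtrancl_induct) (auto simp: grown_step_def)

text \<open>First walk towards the target \<open>F'\<close> until one of its edges is included, then grow the part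
  shared with \<open>F'\<close> edge by edge.\<close>

lemma grown_steps:
  assumes D: "grown False D" and F: "F \<subseteq> D" "card F = k" "grown t F"
    and F': "F' \<subseteq> D" "card F' = k" "grown t F'"
  shows "(F, F') \<in> (grown_step t k D)\<^sup>*"
proof -
  let ?R = "\<lambda>G. (F, G) \<in> (grown_step t k D)\<^sup>*"
  have inv: "G \<subseteq> D" "card G = k" "grown t G" if "?R G" for G
    using grown_steps_invariant[OF that F] by auto
  define W where "W = {e \<in> D. \<exists>G. ?R G \<and> e \<in> G}"
  have "F \<subseteq> W" using F(1) by (auto simp: W_def)
  then have "W \<noteq> {}" using grown_nonempty[OF F(3)] by blast
  \<comment> \<open>An edge touching a reached edge can be swapped in, and \<open>D\<close> is
    connected, so every edge of \<open>D\<close> occurs in some reachable set.\<close>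
  have W: "W = D"
  proof (rule ccontr)
    assume "W \<noteq> D"
    then have "W \<subset> D" by (auto simp: W_def)
    then obtain g where g: "g \<in> D - W" "g \<inter> incident_vertices W \<noteq> {}"
      using ex_touching_edge[OF D \<open>W \<noteq> {}\<close>] by blast
    then obtain e G where G: "?R G" "e \<in> G" "g \<inter> e \<noteq> {}"
      by (auto simp: W_def incident_vertices_def)
    have gG: "g \<notin> G" using g(1) G(1) by (auto simp: W_def)
    have touch: "g \<inter> incident_vertices G \<noteq> {}"
      using G(2,3) subset_incident_vertices by blast
    have "card g = 2" using g(1) grown_card_edge[OF D] by blast
    then obtain f where f: "f \<in> G" "grown t (insert g G - {f})"
      using grown_single_exchange[OF inv(3)[OF G(1)] _ gG touch] by blast
    then have "(G, insert g G - {f}) \<in> grown_step t k D"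
      using inv[OF G(1)] g(1) gG touch by (intro grown_stepI) auto
    with G(1) have "?R (insert g G - {f})" by (rule rtrancl_into_rtrancl)
    then have "g \<in> W" using g(1) gG f(1) by (auto simp: W_def)
    then show False using g(1) by blast
  qed
  have "\<exists>G. ?R G \<and> C \<subseteq> G" if "grown t C" "C \<subseteq> F'" for C
    using that
  proof (induction rule: grown.induct)
    case (single e)
    then have "e \<in> W" using W F'(1) by auto
    then show ?case by (auto simp: W_def)
  next
    case (add C e)
    then obtain G where G: "?R G" "C \<subseteq> G" by auto
    show ?case
    proof (cases "e \<in> G")
      case True
      then show ?thesis using G by blast
    next
      case False
      have touch: "e \<inter> incident_vertices G \<noteq> {}"
        using add.hyps(4) incident_vertices_mono[OF G(2)] by blast
      \<comment> \<open>As \<open>insert e C\<close> fits into \<open>F'\<close>, \<open>C\<close>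
        has fewer than \<open>k\<close> edges, so \<open>G\<close> has an edge outside
        \<open>C\<close> to give up.\<close>
      have "card (insert e C) \<le> k"
        using add.prems F'(2) grown_finite[OF F'(3)] card_mono by blast
      then have "card C < card G"
        using add.hyps(2) grown_finite[OF add.hyps(1)] inv(2)[OF G(1)] by simp
      moreover have "grown t (insert e C)" using add.hyps by (intro grown.add)
      ultimately obtain f where f: "f \<in> G - C" "grown t (insert e G - {f})"
        using grown_exchange[OF inv(3)[OF G(1)] G(2) _ _ False touch] by blast
      then have "(G, insert e G - {f}) \<in> grown_step t k D"
        using inv[OF G(1)] add.prems F'(1) False touch by (intro grown_stepI) auto
      with G(1) have "?R (insert e G - {f})" by (rule rtrancl_into_rtrancl)
      moreover have "insert e C \<subseteq> insert e G - {f}" using f(1) G(2) False by blast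
      ultimately show ?thesis by blast
    qed
  qed
  then obtain G where G: "?R G" "F' \<subseteq> G" using F'(3) by blast
  then have "F' = G"
    using F'(2) inv[OF G(1)] grown_finite by (intro card_subset_eq) auto
  then show ?thesis using G(1) by simp
qed

section \<open>Connected graphs and trees are grown\<close>

lemma adjacency_sym: "(u, v) \<in> (adjacency F)\<^sup>* \<Longrightarrow> (v, u) \<in> (adjacency F)\<^sup>*"
  by (rule symD[OF sym_rtrancl]) (auto simp: adjacency_def sym_def insert_commute)

lemma adjacency_mono: "F \<subseteq> F' \<Longrightarrow> (u, v) \<in> (adjacency F)\<^sup>* \<Longrightarrow> (u, v) \<in> (adjacency F')\<^sup>*"
  by (rule subsetD[OF rtrancl_mono]) (auto simp: adjacency_def)

lemma connected_graph_root:
  assumes "r \<in> U" "\<And>u. u \<in> U \<Longrightarrow> (u, r) \<in> (adjacency F)\<^sup>*"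
  shows "connected_graph U F"
  unfolding connected_graph_def
proof (intro conjI ballI)
  show "U \<noteq> {}" using assms(1) by blast
  fix u v assume "u \<in> U" "v \<in> U"
  then show "(u, v) \<in> (adjacency F)\<^sup>*"
    using rtrancl_trans[OF assms(2) adjacency_sym[OF assms(2)]] by blast
qed

lemma connected_graph_crossing:
  assumes conn: "connected_graph U F" and W: "W \<noteq> {}" "W \<subset> U"
    and F: "\<And>e. e \<in> F \<Longrightarrow> e \<subseteq> U"
  shows "\<exists>j\<in>W. \<exists>i\<in>U - W. {j, i} \<in> F"
proof (rule ccontr)
  assume *: "\<not> (\<exists>j\<in>W. \<exists>i\<in>U - W. {j, i} \<in> F)"
  obtain u v where uv: "u \<in> W" "v \<in> U - W" using W by blast
  then have "(u, v) \<in> (adjacency F)\<^sup>*" using conn W(2) unfolding connected_graph_def by blast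
  then have "v \<in> W"
    using uv(1) * F by (induction rule: rtrancl_induct) (auto simp: adjacency_def)
  then show False using uv(2) by blast
qed

lemma grown_connected_graph: "grown t F \<Longrightarrow> connected_graph (incident_vertices F) F"
proof (induction rule: grown.induct)
  case (single e)
  then obtain u v where e: "e = {u, v}" by (auto simp: card_2_iff)
  show ?case by (rule connected_graph_root[of u]) (auto simp: e adjacency_def insert_commute)
next
  case (add F e)
  then obtain r where r: "r \<in> e" "r \<in> incident_vertices F" by blast
  show ?case
  proof (rule connected_graph_root[of r])
    fix u assume u: "u \<in> incident_vertices (insert e F)"
    show "(u, r) \<in> (adjacency (insert e F))\<^sup>*"
    proof (cases "u \<in> incident_vertices F")
      case True
      then have "(u, r) \<in> (adjacency F)\<^sup>*"
        using add.IH r(2) unfolding connected_graph_def by blast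
      then show ?thesis by (rule adjacency_mono[rotated]) auto
    next
      case False
      then have "u \<in> e" "u \<noteq> r" using u r(2) by auto
      then have "e = {u, r}" using r(1) add.hyps(3) by (auto simp: card_2_iff)
      then show ?thesis by (auto simp: adjacency_def)
    qed
  qed (use r in auto)
qed

lemma maximal_grown:
  assumes "finite F" "e \<in> F" "card e = 2"
  shows "\<exists>M. grown t M \<and> M \<subseteq> F \<and> (\<forall>g\<in>F - M. \<not> grown t (insert g M))"
proof -
  let ?S = "{M. grown t M \<and> M \<subseteq> F}"
  have "finite ?S" using assms(1) by (auto intro: finite_subset[of _ "Pow F"])
  moreover have "{e} \<in> ?S" using assms by (auto intro: grown.single)
  then have "?S \<noteq> {}" by blast
  ultimately have "\<exists>M\<in>?S. \<forall>M'\<in>?S. M \<subseteq> M' \<longrightarrow> M = M'" by (rule finite_has_maximal)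
  then obtain M where M: "M \<in> ?S" "\<forall>M'\<in>?S. M \<subseteq> M' \<longrightarrow> M = M'" by (elim bexE)
  have "\<not> grown t (insert g M)" if "g \<in> F - M" for g
  proof
    assume "grown t (insert g M)"
    then have "insert g M \<in> ?S" using M(1) that by simp
    then have "M = insert g M" using M(2) by (meson subset_insertI)
    then show False using that by auto
  qed
  then show ?thesis using M(1) by blast
qed

text \<open>No remaining edge touches a maximal grown subset; connectedness then forces it to cover
  all vertices, so no edge remains.\<close>

lemma connected_graph_grown:
  assumes fin: "finite F" and F: "\<And>e. e \<in> F \<Longrightarrow> card e = 2"
    and conn: "connected_graph (incident_vertices F) F"
  shows "grown False F"
proof -
  obtain e where e: "e \<in> F" using conn by (auto simp: connected_graph_def incident_vertices_def)
  obtain M where M: "grown False M" "M \<subseteq> F" "\<And>g. g \<in> F - M \<Longrightarrow> \<not> grown False (insert g M)"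
    using maximal_grown[OF fin e F[OF e], of False] by metis
  have no_touch: "g \<inter> incident_vertices M = {}" if "g \<in> F - M" for g
  proof (rule ccontr)
    assume "g \<inter> incident_vertices M \<noteq> {}"
    then have "grown False (insert g M)" using M(1) that F by (auto intro: grown.add)
    then show False using M(3)[OF that] by simp
  qed
  have "M \<noteq> {}" by (rule grown_nonempty[OF M(1)])
  then obtain m where "m \<in> M" by blast
  then have "card m = 2" by (rule grown_card_edge[OF M(1)])
  then have "m \<noteq> {}" by auto
  then have ne: "incident_vertices M \<noteq> {}" using subset_incident_vertices[OF \<open>m \<in> M\<close>] by blast
  have verts: "incident_vertices M = incident_vertices F"
  proof (rule ccontr)
    assume "incident_vertices M \<noteq> incident_vertices F"
    then have "incident_vertices M \<subset> incident_vertices F"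
      using incident_vertices_mono[OF M(2)] by blast
    from connected_graph_crossing[OF conn ne this subset_incident_vertices]
    obtain j i where ji: "j \<in> incident_vertices M" "i \<notin> incident_vertices M" "{j, i} \<in> F"
      by blast
    then have "{j, i} \<in> F - M" using subset_incident_vertices[of "{j, i}" M] by blast
    from no_touch[OF this] ji(1) show False by blast
  qed
  have "F \<subseteq> M"
  proof
    fix g assume "g \<in> F"
    show "g \<in> M"
    proof (rule ccontr)
      assume "g \<notin> M"
      then have "g \<inter> incident_vertices M = {}" using \<open>g \<in> F\<close> by (intro no_touch) simp
      moreover have "g \<noteq> {}" using F[OF \<open>g \<in> F\<close>] by auto
      ultimately show False
        using subset_incident_vertices[OF \<open>g \<in> F\<close>] verts by blast
    qed
  qed
  then show ?thesis using M(1,2) by (simp add: subset_antisym)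
qed

section \<open>Paths, cycles and the characterisation of trees\<close>

lemma distinct_path:
  "(u, v) \<in> (adjacency F)\<^sup>* \<Longrightarrow>
    \<exists>vs. vs \<noteq> [] \<and> hd vs = u \<and> last vs = v \<and> distinct vs \<and>
      (\<forall>i. Suc i < length vs \<longrightarrow> {vs ! i, vs ! Suc i} \<in> F)"
proof (induction rule: rtrancl_induct)
  case base
  show ?case by (intro exI[of _ "[u]"]) auto
next
  case (step v w)
  then obtain vs where vs: "vs \<noteq> []" "hd vs = u" "last vs = v" "distinct vs"
    "\<And>i. Suc i < length vs \<Longrightarrow> {vs ! i, vs ! Suc i} \<in> F" by blast
  show ?case
  \<comment> \<open>A vertex that already occurs closes a loop, which is removed by cutting the path
    back to it.\<close>
  proof (cases "w \<in> set vs")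
    case True
    then obtain n where n: "n < length vs" "vs ! n = w" by (auto simp: in_set_conv_nth)
    let ?ws = "take (Suc n) vs"
    have "last ?ws = w" using n by (simp add: take_Suc_conv_app_nth)
    then show ?thesis using vs n by (intro exI[of _ ?ws]) (auto simp: hd_take)
  next
    case False
    let ?ws = "vs @ [w]"
    have "{?ws ! i, ?ws ! Suc i} \<in> F" if "Suc i < length ?ws" for i
    proof (cases "Suc i < length vs")
      case True
      then show ?thesis using vs(5) by (simp add: nth_append)
    next
      case False
      then have "i = length vs - 1" "Suc i = length vs" using that by auto
      then show ?thesis
        using step.hyps(2) vs(1,3) by (simp add: nth_append last_conv_nth adjacency_def)
    qed
    then show ?thesis using vs False by (intro exI[of _ ?ws]) auto
  qed
qed

text \<open>A repetition-free path in \<open>M\<close> is closed by the edge between its ends. It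
  has at least three vertices, since with two that edge would belong to \<open>M\<close>.\<close>

lemma chord_cycle:
  assumes "(u, v) \<in> (adjacency M)\<^sup>*" "u \<noteq> v" "{u, v} \<notin> M" "{u, v} \<in> F" "M \<subseteq> F"
  shows "\<exists>vs. graph_cycle F vs"
proof -
  obtain vs where vs: "vs \<noteq> []" "hd vs = u" "last vs = v" "distinct vs"
    "\<And>i. Suc i < length vs \<Longrightarrow> {vs ! i, vs ! Suc i} \<in> M"
    using distinct_path[OF assms(1)] by blast
  have first: "vs ! 0 = u" and last: "vs ! (length vs - 1) = v"
    using vs(1-3) by (simp_all add: hd_conv_nth last_conv_nth)
  have "length vs \<noteq> 0" using vs(1) by simp
  moreover have "length vs \<noteq> 1" using first last assms(2) by auto
  moreover have "length vs \<noteq> 2"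
  proof
    assume "length vs = 2"
    then show False using vs(5)[of 0] first last assms(3) by simp
  qed
  ultimately have len: "3 \<le> length vs" by linarith
  have "{vs ! i, vs ! (Suc i mod length vs)} \<in> F" if "i < length vs" for i
  proof (cases "Suc i < length vs")
    case True
    then show ?thesis using vs(5)[OF True] assms(5) by auto
  next
    case False
    then have "i = length vs - 1" "Suc i = length vs" using that by auto
    then show ?thesis using first last assms(4) by (simp add: insert_commute)
  qed
  then show ?thesis using len vs(4) by (auto simp: graph_cycle_def)
qed

text \<open>In the enlarged graph \<open>u\<close> is the only neighbour of \<open>w\<close>, but a
  vertex on a cycle has two different neighbours.\<close>

lemma no_cycle_through_leaf:
  assumes no_cycle: "\<nexists>vs. graph_cycle F vs" and w: "w \<notin> incident_vertices F" and "u \<noteq> w"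
  shows "\<nexists>vs. graph_cycle (insert {u, w} F) vs"
proof
  assume "\<exists>vs. graph_cycle (insert {u, w} F) vs"
  then obtain vs where vs: "3 \<le> length vs" "distinct vs"
    "\<And>i. i < length vs \<Longrightarrow> {vs ! i, vs ! (Suc i mod length vs)} \<in> insert {u, w} F"
    by (auto simp: graph_cycle_def)
  let ?n = "length vs"
  have in_F: "e \<notin> F" if "w \<in> e" for e using w that by (auto simp: incident_vertices_def)
  show False
  proof (cases "w \<in> set vs")
    case True
    then obtain i where i: "i < ?n" "vs ! i = w" by (auto simp: in_set_conv_nth)
    \<comment> \<open>\<open>j\<close> and \<open>l\<close> are the cyclic predecessor and successor
      of position \<open>i\<close>; they differ because the cycle has length at least three.\<close>
    define j where "j = (if i = 0 then ?n - 1 else i - 1)"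
    define l where "l = (if Suc i = ?n then 0 else Suc i)"
    have jl: "j < ?n" "l < ?n" "j \<noteq> l" using i vs(1) by (auto simp: j_def l_def)
    have "Suc j mod ?n = i" "Suc i mod ?n = l" using i vs(1) by (auto simp: j_def l_def)
    then have "{vs ! j, w} = {u, w}" "{w, vs ! l} = {u, w}"
      using vs(3)[OF jl(1)] vs(3)[OF i(1)] i(2) in_F by auto
    then have "vs ! j = vs ! l" by (metis doubleton_eq_iff)
    then show False using jl vs(2) by (simp add: nth_eq_iff_index_eq)
  next
    case False
    have "{vs ! i, vs ! (Suc i mod ?n)} \<in> F" if "i < ?n" for i
    proof -
      have "Suc i mod ?n < ?n" using that by (intro mod_less_divisor) linarith
      then have "w \<noteq> vs ! i" "w \<noteq> vs ! (Suc i mod ?n)" using that False by (metis nth_mem)+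
      then show ?thesis using vs(3)[OF that] by auto
    qed
    then show False using no_cycle vs(1,2) by (auto simp: graph_cycle_def)
  qed
qed

lemma grown_tree_graph:
  fixes F :: "'a set set"
  assumes F: "grown True F"
  shows "tree_graph (incident_vertices F) F"
proof -
  from F have "\<nexists>vs. graph_cycle F vs"
  proof (induction rule: grown.induct)
    case (single e)
    then obtain u w where "e = {u, w}" "u \<noteq> w" by (auto simp: card_2_iff)
    moreover have "\<nexists>vs :: 'a list. graph_cycle {} vs"
    proof
      assume "\<exists>vs :: 'a list. graph_cycle {} vs"
      then obtain vs :: "'a list" where vs: "3 \<le> length vs"
        "\<And>i. i < length vs \<Longrightarrow> {vs ! i, vs ! (Suc i mod length vs)} \<in> {}"
        unfolding graph_cycle_def by blast
      have "0 < length vs" using vs(1) by linarith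
      then show False using vs(2) by blast
    qed
    ultimately show ?case using no_cycle_through_leaf[of "{}" w u] by simp
  next
    case (add F e)
    then obtain u w where "e = {u, w}" "u \<in> incident_vertices F" "w \<notin> incident_vertices F"
      using card_2_Un by metis
    then show ?case using no_cycle_through_leaf[of F w u] add.IH by auto
  qed
  then show ?thesis using grown_connected_graph[OF F] by (simp add: tree_graph_def)
qed

text \<open>A maximal grown tree inside \<open>F\<close> spans all vertices, for otherwise an edge
  leaving its vertex set would extend it; any further edge of \<open>F\<close> would close a
  cycle.\<close>

lemma tree_graph_grown:
  assumes fin: "finite F" and F: "\<And>e. e \<in> F \<Longrightarrow> card e = 2"
    and tree: "tree_graph (incident_vertices F) F"
  shows "grown True F"
proof -
  have conn: "grown False F"
    using connected_graph_grown[OF fin F] tree by (simp add: tree_graph_def)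
  obtain e where e: "e \<in> F" using grown_nonempty[OF conn] by blast
  obtain M where M: "grown True M" "M \<subseteq> F" "\<And>g. g \<in> F - M \<Longrightarrow> \<not> grown True (insert g M)"
    using maximal_grown[OF fin e F[OF e], of True] by metis
  have verts: "incident_vertices M = incident_vertices F"
  proof (rule ccontr)
    assume "incident_vertices M \<noteq> incident_vertices F"
    from ex_leaving_edge[OF conn grown_nonempty[OF M(1)] M(2) this]
    obtain g where g: "g \<in> F - M" "g \<inter> incident_vertices M \<noteq> {}" "\<not> g \<subseteq> incident_vertices M"
      by blast
    then have "grown True (insert g M)" using M(1) F by (auto intro: grown.add)
    then show False using M(3)[OF g(1)] by simp
  qed
  have "M = F"
  proof (rule ccontr)
    assume "M \<noteq> F"
    then obtain g where g: "g \<in> F" "g \<notin> M" using M(2) by blast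
    obtain u v where uv: "g = {u, v}" "u \<noteq> v" using F[OF g(1)] by (auto simp: card_2_iff)
    have "u \<in> incident_vertices M" "v \<in> incident_vertices M"
      using subset_incident_vertices[OF g(1)] uv(1) verts by auto
    then have "(u, v) \<in> (adjacency M)\<^sup>*"
      using grown_connected_graph[OF M(1)] unfolding connected_graph_def by blast
    then have "\<exists>vs. graph_cycle F vs" using chord_cycle[of u v M F] uv g M(2) by simp
    then show False using tree by (simp add: tree_graph_def)
  qed
  then show ?thesis using M(1) by simp
qed

lemma grown_Un:
  assumes F: "grown t F" and F': "grown t' F'"
    and meet: "incident_vertices F \<inter> incident_vertices F' \<noteq> {}"
  shows "grown False (F \<union> F')"
proof (rule connected_graph_grown)
  show "finite (F \<union> F')" using grown_finite[OF F] grown_finite[OF F'] by simp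
  show "card e = 2" if "e \<in> F \<union> F'" for e
    using that grown_card_edge[OF F] grown_card_edge[OF F'] by blast
  obtain r where r: "r \<in> incident_vertices F" "r \<in> incident_vertices F'" using meet by blast
  show "connected_graph (incident_vertices (F \<union> F')) (F \<union> F')"
  proof (rule connected_graph_root[of r])
    fix u assume "u \<in> incident_vertices (F \<union> F')"
    then have "(u, r) \<in> (adjacency F)\<^sup>* \<or> (u, r) \<in> (adjacency F')\<^sup>*"
      using grown_connected_graph[OF F] grown_connected_graph[OF F'] r
      unfolding connected_graph_def by auto
    then show "(u, r) \<in> (adjacency (F \<union> F'))\<^sup>*"
      using adjacency_mono[of F "F \<union> F'"] adjacency_mono[of F' "F \<union> F'"] by blast
  qed (use r in simp)
qed

section \<open>The four families\<close>

lemma grown_family_iff: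
  assumes "simple_graph U E" "1 \<le> k" "F \<subseteq> E" "card F = k"
  shows "grown False F \<longleftrightarrow> connected_graph (incident_vertices F) F"
    and "grown True F \<longleftrightarrow> tree_graph (incident_vertices F) F"
proof -
  have fin: "finite F" using assms(2,4) by (intro card_ge_0_finite) simp
  have two: "card e = 2" if "e \<in> F" for e
    using that assms(1,3) by (auto simp: simple_graph_def)
  show "grown False F \<longleftrightarrow> connected_graph (incident_vertices F) F"
    using connected_graph_grown[OF fin two] grown_connected_graph by blast
  show "grown True F \<longleftrightarrow> tree_graph (incident_vertices F) F"
    using tree_graph_grown[OF fin two] grown_tree_graph by blast
qed

definition edge_family :: "bool \<Rightarrow> 'a set set \<Rightarrow> nat \<Rightarrow> 'a set set set" where
  "edge_family t E k = {F. F \<subseteq> E \<and> card F = k \<and> grown t F}"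

lemma families_grown:
  assumes "simple_graph U E" "1 \<le> k"
  shows "F_ec E k = edge_family False E k" "F_et E k = edge_family True E k"
    "F_vc E k = incident_vertices ` edge_family False E k"
    "F_vt E k = incident_vertices ` edge_family True E k"
proof -
  show ec: "F_ec E k = edge_family False E k"
    unfolding F_ec_def edge_family_def
    by (intro Collect_cong conj_cong refl grown_family_iff(1)[OF assms, symmetric])
  show et: "F_et E k = edge_family True E k"
    unfolding F_et_def edge_family_def
    by (intro Collect_cong conj_cong refl grown_family_iff(2)[OF assms, symmetric])
  show "F_vc E k = incident_vertices ` edge_family False E k"
    unfolding ec[symmetric] by (simp add: F_vc_def F_ec_def setcompr_eq_image)
  show "F_vt E k = incident_vertices ` edge_family True E k"
    unfolding et[symmetric] by (simp add: F_vt_def F_et_def setcompr_eq_image)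
qed

lemma edge_family_steps:
  assumes "grown False D" "D \<subseteq> E" "F \<in> edge_family t E k" "F' \<in> edge_family t E k" "F \<subseteq> D" "F' \<subseteq> D"
  shows "(F, F') \<in> (grown_step t k D)\<^sup>*"
  using assms by (intro grown_steps) (auto simp: edge_family_def)

lemma grown_step_in_family:
  assumes "(F, F') \<in> grown_step t k D" "D \<subseteq> E"
  shows "F \<in> edge_family t E k" "F' \<in> edge_family t E k" "F' \<subseteq> D"
  using assms by (auto simp: grown_step_def edge_family_def)

lemma edge_family_single_exchange:
  assumes E: "\<And>e. e \<in> E \<Longrightarrow> card e = 2" and F: "F \<in> edge_family t E k"
    and e: "e \<in> E" "e \<notin> F" "e \<inter> incident_vertices F \<noteq> {}"
  shows "\<exists>f\<in>F. insert e F - {f} \<in> edge_family t E k"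
proof -
  have F': "F \<subseteq> E" "card F = k" "grown t F" using F by (auto simp: edge_family_def)
  obtain f where f: "f \<in> F" "grown t (insert e F - {f})"
    using grown_single_exchange[OF F'(3) E[OF e(1)] e(2,3)] by blast
  then have "(F, insert e F - {f}) \<in> grown_step t k E"
    using F' e by (intro grown_stepI) auto
  from grown_step_in_family(2)[OF this] f(1) show ?thesis by blast
qed

text \<open>With \<open>2 \<le> k\<close>, some edge other than \<open>f\<close> is kept, so
  consecutive edge sets overlap as \<open>exchange\<close> demands.\<close>

lemma grown_step_edges:
  assumes step: "(F, F') \<in> grown_step t k D" and "D \<subseteq> E" "2 \<le> k"
  shows "(F, F') \<in> exchange (edge_family t E k) D"
proof -
  obtain e f where ef: "F' = insert e F - {f}" "f \<in> F" and F: "card F = k"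
    using step by (auto simp: grown_step_def)
  have "card (F' - F) \<le> card {e}" unfolding ef(1) by (rule card_mono) auto
  moreover have "card (F - {f}) \<noteq> 0"
    using F assms(3) ef(2) by (simp add: card_Diff_singleton)
  then have "F - {f} \<noteq> {}" by (metis card.empty)
  then have "F \<inter> F' \<noteq> {}" using ef(1) by blast
  ultimately show ?thesis
    using grown_step_in_family[OF step assms(2)] by (simp add: exchange_def)
qed

text \<open>The new edge touches \<open>F\<close>, so it adds at most one vertex, and the touching vertex is kept.\<close>

lemma grown_step_vertices:
  assumes step: "(F, F') \<in> grown_step t k D" and "D \<subseteq> E"
  shows "(incident_vertices F, incident_vertices F') \<in>
    exchange (incident_vertices ` edge_family t E k) (incident_vertices D)"
proof -
  obtain e f where ef: "F' = insert e F - {f}" "e \<notin> F" "f \<in> F" "e \<inter> incident_vertices F \<noteq> {}"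
    and F': "grown t F'"
    using step by (auto simp: grown_step_def)
  have eF': "e \<in> F'" using ef by auto
  obtain v where v: "v \<in> e" "v \<in> incident_vertices F" using ef(4) by blast
  have two: "card e = 2" by (rule grown_card_edge[OF F' eF'])
  have sub: "incident_vertices F' \<subseteq> incident_vertices (insert e F)"
    unfolding ef(1) by (rule incident_vertices_mono) auto
  then have "incident_vertices F' - incident_vertices F \<subseteq> e - {v}" using v by auto
  then have "card (incident_vertices F' - incident_vertices F) \<le> card (e - {v})"
    using card_2_finite[OF two] by (intro card_mono) auto
  also have "\<dots> \<le> 1" using two v(1) by (simp add: card_Diff_singleton)
  finally have "card (incident_vertices F' - incident_vertices F) \<le> 1" .
  moreover have "v \<in> incident_vertices F'" using v(1) subset_incident_vertices[OF eF'] by blast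
  then have "incident_vertices F \<inter> incident_vertices F' \<noteq> {}" using v(2) by blast
  moreover have "incident_vertices F' \<subseteq> incident_vertices D"
    using grown_step_in_family[OF step assms(2)] by (intro incident_vertices_mono)
  ultimately show ?thesis
    using grown_step_in_family[OF step assms(2)] by (simp add: exchange_def)
qed

section \<open>Exchange properties of the families of a connected graph\<close>

locale connected_simple_graph =
  fixes U :: "'a set" and E :: "'a set set" and k :: nat
  assumes simple: "simple_graph U E" and conn: "connected_graph U E"
    and k: "1 \<le> k" "k < card E"
begin

lemma card_edge: "e \<in> E \<Longrightarrow> card e = 2"
  and edge_sub: "e \<in> E \<Longrightarrow> e \<subseteq> U"
  using simple by (auto simp: simple_graph_def)

lemma E_nonempty: "E \<noteq> {}"
  using k by auto

text \<open>A connected graph with at least one edge has no isolated vertex.\<close>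

lemma incident_E: "incident_vertices E = U"
proof (rule ccontr)
  assume "incident_vertices E \<noteq> U"
  moreover have "incident_vertices E \<subseteq> U" using edge_sub by (auto simp: incident_vertices_def)
  ultimately have sub: "incident_vertices E \<subset> U" by blast
  obtain e where e: "e \<in> E" using E_nonempty by blast
  have "e \<noteq> {}" using card_edge[OF e] by auto
  then have ne: "incident_vertices E \<noteq> {}" using subset_incident_vertices[OF e] by blast
  obtain j i where "i \<in> U - incident_vertices E" "{j, i} \<in> E"
    using connected_graph_crossing[OF conn ne sub edge_sub] by blast
  then show False using subset_incident_vertices[of "{j, i}" E] by blast
qed

lemma finite_E: "finite E"
  using families_are_hypergraphs[OF simple k(1)] by simp

lemma E_grown: "grown False E"
  using connected_graph_grown[OF finite_E card_edge] conn incident_E by simp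

lemma JM_edges:
  assumes k2: "2 \<le> k" and mtf: "minimal_transversal_free E (edge_family t E k)"
  shows "JM E (edge_family t E k)"
proof -
  have chain: "(A, B) \<in> (exchange (edge_family t E k) D)\<^sup>*"
    if "grown False D" "D \<subseteq> E" "A \<in> edge_family t E k" "B \<in> edge_family t E k" "A \<subseteq> D" "B \<subseteq> D" for A B D
    using edge_family_steps[OF that] grown_step_edges[OF _ that(2) k2]
    by (meson rtrancl_mono subrelI subsetD)
  interpret exchange_hypergraph E "edge_family t E k"
  proof
    show "finite E" by (rule finite_E)
    show "edge_family t E k \<subseteq> Pow E - {{}}" using k(1) by (auto simp: edge_family_def)
    show "E \<noteq> {}" by (rule E_nonempty)
    show "minimal_transversal_free E (edge_family t E k)" by (rule mtf)
  next
    fix A B assume AB: "A \<in> edge_family t E k" "B \<in> edge_family t E k"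
    then have gr: "A \<subseteq> E" "B \<subseteq> E" "grown t A" "grown t B" by (auto simp: edge_family_def)
    show "(A, B) \<in> (exchange (edge_family t E k) E)\<^sup>*"
      using E_grown AB gr by (intro chain) auto
    assume "A \<inter> B \<noteq> {}"
    \<comment> \<open>A common edge yields a common vertex, so \<open>A \<union> B\<close> is
      connected and can host the walk.\<close>
    then obtain e where e: "e \<in> A" "e \<in> B" by blast
    have "e \<noteq> {}" using card_edge e(1) gr(1) by fastforce
    then have "incident_vertices A \<inter> incident_vertices B \<noteq> {}"
      using subset_incident_vertices[OF e(1)] subset_incident_vertices[OF e(2)] by blast
    then have "grown False (A \<union> B)" by (rule grown_Un[OF gr(3,4)])
    then show "(A, B) \<in> (exchange (edge_family t E k) (A \<union> B))\<^sup>*"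
      using AB gr by (intro chain) auto
  next
    fix W assume W: "W \<subset> E" "W \<noteq> {}"
    \<comment> \<open>\<open>g\<close> shares a vertex with some \<open>j\<close> in
      \<open>W\<close>, hence touches every member containing \<open>j\<close> and can be exchanged
      into it.\<close>
    obtain g where g: "g \<in> E - W" "g \<inter> incident_vertices W \<noteq> {}"
      using ex_touching_edge[OF E_grown W(2,1)] by blast
    then obtain j where j: "j \<in> W" "g \<inter> j \<noteq> {}" by (auto simp: incident_vertices_def)
    have "\<exists>A'\<in>edge_family t E k. g \<in> A' \<and> A' \<subseteq> insert g A"
      if A: "A \<in> edge_family t E k" "j \<in> A" "g \<notin> A" for A
    proof -
      have "g \<inter> incident_vertices A \<noteq> {}" using j(2) subset_incident_vertices[OF A(2)] by blast
      then obtain f where "f \<in> A" "insert g A - {f} \<in> edge_family t E k"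
        using edge_family_single_exchange[OF card_edge A(1) _ A(3)] g(1) by blast
      then show ?thesis
        using A(3) by (intro bexI[of _ "insert g A - {f}"]) auto
    qed
    then show "\<exists>j\<in>W. \<exists>i\<in>E - W. \<forall>A\<in>edge_family t E k. j \<in> A \<longrightarrow>
        i \<in> A \<or> (\<exists>A'\<in>edge_family t E k. i \<in> A' \<and> A' \<subseteq> insert i A)"
      using j(1) g(1) by blast
  qed
  show ?thesis by (rule JM_exchange_hypergraph)
qed

lemma JM_vertices:
  assumes mtf: "minimal_transversal_free U (incident_vertices ` edge_family t E k)"
  shows "JM U (incident_vertices ` edge_family t E k)"
proof -
  let ?H = "incident_vertices ` edge_family t E k"
  have chain: "(incident_vertices A, incident_vertices B) \<in> (exchange ?H (incident_vertices D))\<^sup>*"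
    if "grown False D" "D \<subseteq> E" "A \<in> edge_family t E k" "B \<in> edge_family t E k" "A \<subseteq> D" "B \<subseteq> D" for A B D
    using edge_family_steps[OF that]
  proof (induction rule: rtrancl_induct)
    case (step B C)
    show ?case
      using step.IH grown_step_vertices[OF step.hyps(2) that(2)] by (rule rtrancl_into_rtrancl)
  qed simp
  interpret exchange_hypergraph U ?H
  proof
    show "finite U" using simple by (simp add: simple_graph_def)
    show "?H \<subseteq> Pow U - {{}}"
      using families_are_hypergraphs(5,6)[OF simple k(1)] families_grown[OF simple k(1)]
      by (cases t) auto
    show "U \<noteq> {}" using conn by (simp add: connected_graph_def)
    show "minimal_transversal_free U ?H" by (rule mtf)
  next
    fix A B assume "A \<in> ?H" "B \<in> ?H"
    then obtain F F' where F: "A = incident_vertices F" "F \<in> edge_family t E k"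
      and F': "B = incident_vertices F'" "F' \<in> edge_family t E k" by blast
    then have gr: "F \<subseteq> E" "F' \<subseteq> E" "grown t F" "grown t F'" by (auto simp: edge_family_def)
    show "(A, B) \<in> (exchange ?H U)\<^sup>*"
      using chain[OF E_grown order_refl F(2) F'(2) gr(1,2)] F(1) F'(1) incident_E by simp
    assume "A \<inter> B \<noteq> {}"
    then have "grown False (F \<union> F')" using F(1) F'(1) by (intro grown_Un[OF gr(3,4)]) simp
    \<comment> \<open>The connected edge set \<open>F \<union> F'\<close> has exactly
      \<open>A \<union> B\<close> as its vertices, so the walk inside it is local.\<close>
    then show "(A, B) \<in> (exchange ?H (A \<union> B))\<^sup>*"
      using chain[of "F \<union> F'" F F'] F F' gr by simp
  next
    fix W assume W: "W \<subset> U" "W \<noteq> {}"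
    obtain j i where ji: "j \<in> W" "i \<in> U - W" "{j, i} \<in> E"
      using connected_graph_crossing[OF conn W(2,1) edge_sub] by blast
    \<comment> \<open>Swapping in the edge from \<open>j\<close> to \<open>i\<close> adds only the
      vertex \<open>i\<close>. Dropping \<open>f\<close> may lose vertices, which is harmless for an
      inclusion in \<open>insert i A\<close>.\<close>
    have "\<exists>A'\<in>?H. i \<in> A' \<and> A' \<subseteq> insert i A" if "A \<in> ?H" and A: "j \<in> A" "i \<notin> A" for A
    proof -
      from that obtain F where F: "A = incident_vertices F" "F \<in> edge_family t E k" by blast
      have new: "{j, i} \<notin> F" using subset_incident_vertices[of "{j, i}" F] A(2) F(1) by blast
      have "{j, i} \<inter> incident_vertices F \<noteq> {}" using A(1) F(1) by blast
      then obtain f where f: "f \<in> F" "insert {j, i} F - {f} \<in> edge_family t E k"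
        using edge_family_single_exchange[OF card_edge F(2) ji(3) new] by blast
      let ?F = "insert {j, i} F - {f}"
      have "{j, i} \<in> ?F" using f(1) new by blast
      from subset_incident_vertices[OF this] have "i \<in> incident_vertices ?F" by simp
      moreover have "incident_vertices ?F \<subseteq> incident_vertices (insert {j, i} F)"
        by (rule incident_vertices_mono) blast
      then have "incident_vertices ?F \<subseteq> insert i A" using A(1) F(1) by (simp add: insert_absorb)
      ultimately show ?thesis
        using f(2) by (intro bexI[of _ "incident_vertices ?F"] conjI imageI)
    qed
    then show "\<exists>j\<in>W. \<exists>i\<in>U - W. \<forall>A\<in>?H. j \<in> A \<longrightarrow> i \<in> A \<or> (\<exists>A'\<in>?H. i \<in> A' \<and> A' \<subseteq> insert i A)"
      using ji(1,2) by blast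
  qed
  show ?thesis by (rule JM_exchange_hypergraph)
qed

end

theorem theorem5p11:
  fixes U :: "'a set" and E :: "'a set set" and k :: nat
  assumes "simple_graph U E" and "connected_graph U E"
    and "1 \<le> k" and "k < card E"
  shows "(2 \<le> k \<longrightarrow>
            (minimal_transversal_free E (F_ec E k) \<longrightarrow> JM E (F_ec E k)) \<and>
            (minimal_transversal_free E (F_et E k) \<longrightarrow> JM E (F_et E k))) \<and>
         (minimal_transversal_free U (F_vc E k) \<longrightarrow> JM U (F_vc E k)) \<and>
         (minimal_transversal_free U (F_vt E k) \<longrightarrow> JM U (F_vt E k))"
proof -
  interpret connected_simple_graph U E k by standard (fact assms)+
  show ?thesis
    unfolding families_grown[OF assms(1,3)] by (intro conjI impI JM_edges JM_vertices)
qed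

end
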